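(* Let $s\in(0,1)$ and let $\mathcal L$ be any of the classes $\mathcal L_0$, $\mathcal L_1$, $\mathcal L_2$ of order $2s$ defined in the context. For each unit vector $\nu\in S^{n-1}$, let $\beta_1=\beta_1(\nu)\le\beta_2=\beta_2(\nu)$ in $(0,2s)$ be the exponents for which \[ M^+_{\mathcal L}\,(x\cdot\nu)_+^{\beta_1}=0\quad\text{and}\quad M^-_{\mathcal L}\,(x\cdot\nu)_+^{\beta_2}=0\quad\text{in }\{x\cdot\nu>0\}. \] Then $\beta_1<s<\beta_2$.
   Context: Let $0<\lambda\le\Lambda$ be the ellipticity constants. $\mathcal L_0=\mathcal L_0(s)$ is the class of all operators \[Lu(x)=(1-s)\int_{\mathbb R^n}\Bigl(\tfrac{u(x+y)+u(x-y)}{2}-u(x)\Bigr)\frac{b(y)}{|y|^{n+2s}}\,dy,\qquad b\in L^\infty(\mathbb R^n),\quad b(y)=b(-y),\quad \lambda\le b\le\Lambda ;\] the kernel of $L$ is $K(y)=(1-s)b(y)|y|^{-n-2s}$. $\mathcal L_1$ and $\mathcal L_2$ are the subclasses of $\mathcal L_0$ considered by Caffarelli and Silvestre, which have more regular kernels: $\mathcal L_1$ is made of the kernels in $\mathcal L_0$ which are $C^1$ away from the origin, and $\mathcal L_2$ of the kernels in $\mathcal L_0$ which are $C^2$ away from the origin. For a class $\mathcal L$, $M^+_{\mathcal L}u=\sup_{L\in\mathcal L}Lu$ and $M^-_{\mathcal L}u=\inf_{L\in\mathcal L}Lu$. For any class $\mathcal L\subset\mathcal L_0(s)$ that is scale invariant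 of order $2s$ (i.e. if $L\in\mathcal L$ and $R>0$, then the operator $L_R$ defined by $(L_Ru)(R\,\cdot)=R^{-2s}L(u(R\,\cdot))$ belongs to $\mathcal L$), such exponents $\beta_1\le\beta_2$ exist for every $\nu$.
   Formalization: The formal theorem assumes λ < Λ instead of λ ≤ Λ: when λ = Λ each class contains only a multiple of the fractional Laplacian, (x·ν)_+^s is then a solution, so β₁ = β₂ = s and the strict inequalities fail. *)

theory Defs
  imports "HOL-Analysis.Analysis"
begin

(* Differentiability is required at full neighbourhoods, so this is meant for open S.
   In finite dimension, continuity of all directional derivatives of order k
   is continuity of the k-th Frechet derivative. *)
primrec Ck_on :: "nat \<Rightarrow> 'a::euclidean_space set \<Rightarrow> ('a \<Rightarrow> real) \<Rightarrow> bool" where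
  "Ck_on 0 S f \<longleftrightarrow> continuous_on S f"
| "Ck_on (Suc k) S f \<longleftrightarrow>
     (\<forall>x\<in>S. f differentiable (at x)) \<and>
     (\<forall>h. Ck_on k S (\<lambda>x. frechet_derivative f (at x) h))"

type_synonym 'a operator = "('a \<Rightarrow> real) \<Rightarrow> 'a \<Rightarrow> real"

definition kernel :: "real \<Rightarrow> ('a::euclidean_space \<Rightarrow> real) \<Rightarrow> 'a \<Rightarrow> real" where
  "kernel s b y = (1 - s) * b y / norm y powr (real DIM('a) + 2 * s)"

(* The Bochner integral is 0 for non-integrable integrands. For the functions
   pos_power \<beta> \<nu> with 0 < \<beta> < 2 * s and b bounded, the integral converges absolutely
   at every x with x \<bullet> \<nu> > 0. *)
definition integro_op :: "real \<Rightarrow> ('a::euclidean_space \<Rightarrow> real) \<Rightarrow> 'a operator" where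
  "integro_op s b u x = (1 - s) *
     (LINT y|lborel. ((u (x + y) + u (x - y)) / 2 - u x) *
        (b y / norm y powr (real DIM('a) + 2 * s)))"

(* Elements of L-infinity are represented by Borel functions, with conditions
   imposed almost everywhere. *)
definition admissible :: "real \<Rightarrow> real \<Rightarrow> ('a::euclidean_space \<Rightarrow> real) \<Rightarrow> bool" where
  "admissible lam Lam b \<longleftrightarrow>
     b \<in> borel_measurable lborel \<and>
     (AE y in lborel. b y = b (- y)) \<and>
     (AE y in lborel. lam \<le> b y \<and> b y \<le> Lam)"

definition class_L0 :: "real \<Rightarrow> real \<Rightarrow> real \<Rightarrow> 'a::euclidean_space operator set" where
  "class_L0 s lam Lam = {integro_op s b |b. admissible lam Lam b}"

definition class_L1 :: "real \<Rightarrow> real \<Rightarrow> real \<Rightarrow> 'a::euclidean_space operator set" where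
  "class_L1 s lam Lam =
     {integro_op s b |b. admissible lam Lam b \<and> Ck_on 1 (- {0}) (kernel s b)}"

definition class_L2 :: "real \<Rightarrow> real \<Rightarrow> real \<Rightarrow> 'a::euclidean_space operator set" where
  "class_L2 s lam Lam =
     {integro_op s b |b. admissible lam Lam b \<and> Ck_on 2 (- {0}) (kernel s b)}"

(* Extended reals, so that supremum and infimum always exist. *)
definition M_plus :: "'a operator set \<Rightarrow> ('a \<Rightarrow> real) \<Rightarrow> 'a \<Rightarrow> ereal" where
  "M_plus \<L> u x = (SUP L\<in>\<L>. ereal (L u x))"

definition M_minus :: "'a operator set \<Rightarrow> ('a \<Rightarrow> real) \<Rightarrow> 'a \<Rightarrow> ereal" where
  "M_minus \<L> u x = (INF L\<in>\<L>. ereal (L u x))"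

definition pos_power :: "real \<Rightarrow> 'a::euclidean_space \<Rightarrow> 'a \<Rightarrow> real" where
  "pos_power \<beta> \<nu> x = max 0 (x \<bullet> \<nu>) powr \<beta>"

end

(* For a weight b(y) = B(y . nu) the operator applied to (x . nu)_+^beta at nu is a positive multiple of
   the one-dimensional integral of delta(t) B(t) t^(-1-2s) over t > 0, where
   delta(t) = ((1+t)_+^beta + (1-t)_+^beta)/2 - 1. For constant B this integral J is nonnegative for
   beta >= s and nonpositive for beta <= s: after compactifying the half-line it becomes the integral of
   ((1-x)^beta + (1-x)^(2s-1-beta) - 1 - (1-x)^(2s-1)) x^(-1-2s) over (0,1), minus 1/(2s); the integrand is
   monotone in the distance from beta to s - 1/2, and for beta = s it is the derivative of
   (1 - (1-x)^s)^2 x^(-2s) / (2s). Since delta changes sign only once, a smooth strictly monotone B moves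
   the integral strictly away from the multiple of J given by the value of B at the sign change. If
   beta_1 >= s, an increasing B thus makes M^+ positive, and if beta_2 <= s, a decreasing B makes M^-
   negative. These weights are smooth, so they are available in all three classes. *)
theory Submission
  imports Defs
begin

section \<open>Smooth ridge weights\<close>

text \<open>For \<beta> = s the integral J is zero, so constant weights decide nothing there:
  strictness has to come from a nonconstant weight, which needs room between \<open>lam\<close> and
  \<open>Lam\<close>. The profile \<open>1 / (1 + t\<^sup>2)\<close> is even, strictly decreasing
  for t > 0, has values in (0, 1], and is the reciprocal of a positive polynomial. The obstacle in
  finding the sign of J is a cancellation at 0. The parts of delta with 1 + t and with 1 - t are
  each of order t there, and only their sum is of order t^2, so for s >= 1/2 they are not separately
  integrable against the kernel. Everything is therefore cut off at t = e. Only the part with 1 + t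
  is substituted, by t = x/(1-x), which moves its cut-off to e/(1+e). The two cut-offs differ by at
  most e^2 and the integrand between them is of order e^(-2s), so the error is of order e^(2-2s) and
  disappears because s < 1. The substitution turns the exponent \<beta> into 2s-1-\<beta>, its
  reflection about s - 1/2. The reflection of s is s-1 < 0 < \<beta>, so comparing distances to s -
  1/2 amounts to comparing \<beta> with s.\<close>

lemma Ck_on_cong:
  assumes "open S" and "\<And>x. x \<in> S \<Longrightarrow> f x = g x" and "Ck_on k S f"
  shows "Ck_on k S g"
  using assms(2,3)
proof (induction k arbitrary: f g)
  case 0
  then show ?case by (simp cong: continuous_on_cong)
next
  case (Suc k)
  have diff: "g differentiable (at x)" if "x \<in> S" for x
    using Suc.prems that assms(1)
    by (auto simp: differentiable_def) (metis has_derivative_transform_within_open)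
  have fd: "frechet_derivative f (at x) = frechet_derivative g (at x)" if "x \<in> S" for x
    using Suc.prems that assms(1)
    by (intro frechet_derivative_transform_within_open[where X = S]) auto
  have "Ck_on k S (\<lambda>x. frechet_derivative g (at x) h)" for h
    by (rule Suc.IH[of "\<lambda>x. frechet_derivative f (at x) h"]) (use Suc.prems fd in auto)
  with diff show ?case by simp
qed

lemma Ck_on_SucI:
  assumes "open S" and "\<And>x. x \<in> S \<Longrightarrow> (f has_derivative f' x) (at x)"
    and "\<And>h. Ck_on k S (\<lambda>x. f' x h)"
  shows "Ck_on (Suc k) S f"
proof -
  have fd: "frechet_derivative f (at x) = f' x" if "x \<in> S" for x
    using frechet_derivative_at[OF assms(2)[OF that]] by simp
  have "Ck_on k S (\<lambda>x. frechet_derivative f (at x) h)" for h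
    by (rule Ck_on_cong[OF assms(1) _ assms(3)]) (use fd in auto)
  with assms(2) show ?thesis by (auto simp: differentiable_def)
qed

lemma Ck_on_Suc_has_derivative:
  assumes "Ck_on (Suc k) S f" "x \<in> S"
  shows "(f has_derivative frechet_derivative f (at x)) (at x)"
  using assms by (simp add: frechet_derivative_works)

lemma Ck_on_SucD: "Ck_on (Suc k) S f \<Longrightarrow> Ck_on k S f"
proof (induction k arbitrary: f)
  case 0
  then show ?case
    by (auto intro!: differentiable_imp_continuous_on differentiable_at_imp_differentiable_on)
next
  case (Suc k)
  then show ?case by (metis Ck_on.simps(2))
qed

lemma Ck_on_const: "Ck_on k S (\<lambda>x. c)"
  by (induction k arbitrary: c) auto

lemma Ck_on_inner: "open S \<Longrightarrow> Ck_on k S (\<lambda>x. x \<bullet> v)"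
proof (cases k)
  case (Suc m)
  assume "open S"
  have "Ck_on (Suc m) S (\<lambda>x. x \<bullet> v)"
    by (rule Ck_on_SucI[OF \<open>open S\<close>, where f' = "\<lambda>x h. h \<bullet> v"])
      (auto intro!: derivative_eq_intros Ck_on_const)
  with Suc show ?thesis by simp
qed (auto intro!: continuous_intros)

lemma Ck_on_add:
  assumes "open S" "Ck_on k S f" "Ck_on k S g"
  shows "Ck_on k S (\<lambda>x. f x + g x)"
  using assms(2,3)
proof (induction k arbitrary: f g)
  case (Suc k)
  show ?case
    by (rule Ck_on_SucI[OF assms(1)],
        rule has_derivative_add[OF Ck_on_Suc_has_derivative[OF Suc.prems(1)]
          Ck_on_Suc_has_derivative[OF Suc.prems(2)]])
      (use Suc in auto)
qed (auto intro: continuous_on_add)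

lemma Ck_on_mult:
  assumes "open S" "Ck_on k S f" "Ck_on k S g"
  shows "Ck_on k S (\<lambda>x. f x * g x)"
  using assms(2,3)
proof (induction k arbitrary: f g)
  case (Suc k)
  show ?case
    by (rule Ck_on_SucI[OF assms(1)],
        rule has_derivative_mult[OF Ck_on_Suc_has_derivative[OF Suc.prems(1)]
          Ck_on_Suc_has_derivative[OF Suc.prems(2)]])
      (use Suc.IH Suc.prems Ck_on_SucD[OF Suc.prems(1)] Ck_on_SucD[OF Suc.prems(2)]
        in \<open>auto intro!: Ck_on_add[OF assms(1)]\<close>)
qed (auto intro: continuous_on_mult)

text \<open>The induction runs over all exponents at once, because differentiation replaces
  \<open>a\<close> by \<open>a - 1\<close>; positivity of \<open>f\<close> keeps every such power
  differentiable.\<close>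

lemma Ck_on_powr:
  assumes "open S" "\<And>x. x \<in> S \<Longrightarrow> f x > 0" "Ck_on k S f"
  shows "Ck_on k S (\<lambda>x. f x powr a)"
  using assms(3)
proof (induction k arbitrary: a)
  case 0
  then show ?case
    using assms(2) by (force intro!: continuous_on_powr continuous_on_const)
next
  case (Suc k)
  have der: "((\<lambda>x. f x powr a) has_derivative
      (\<lambda>h. a * f x powr (a - 1) * frechet_derivative f (at x) h)) (at x)" if "x \<in> S" for x
  proof -
    have "((\<lambda>y. y powr a) has_real_derivative a * f x powr (a - 1)) (at (f x))"
      using assms(2)[OF that] by (rule has_real_derivative_powr)
    then have "((\<lambda>y. y powr a) has_derivative (\<lambda>y. a * f x powr (a - 1) * y)) (at (f x))"
      by (simp add: has_field_derivative_def)
    from diff_chain_at[OF Ck_on_Suc_has_derivative[OF Suc.prems that] this]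
    show ?thesis by (simp add: o_def)
  qed
  show ?case
    by (rule Ck_on_SucI[OF assms(1) der])
      (use Suc.IH[OF Ck_on_SucD[OF Suc.prems]] Suc.prems
        in \<open>auto intro!: Ck_on_mult[OF assms(1)] Ck_on_const\<close>)
qed

text \<open>Away from the origin the kernel is built from inner products by sums, products and real
  powers of positive functions.\<close>

lemma Ck_on_kernel_ridge:
  fixes \<nu> :: "'a::euclidean_space"
  shows "Ck_on k (- {0}) (kernel s (\<lambda>y. c + d * (1 / (1 + (y \<bullet> \<nu>)\<^sup>2))))"
proof -
  have op: "open (- {0 :: 'a})" by auto
  have sq: "Ck_on k (- {0 :: 'a}) (\<lambda>y. y \<bullet> y)"
  proof -
    have "Ck_on k (- {0 :: 'a}) (\<lambda>y. \<Sum>i\<in>A. (y \<bullet> i) * (y \<bullet> i))" if "finite A" for A :: "'a set"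
      using that by (induction A) (auto intro!: Ck_on_const Ck_on_add Ck_on_mult Ck_on_inner op)
    from Ck_on_cong[OF op _ this[OF finite_Basis]] show ?thesis
      by (simp add: euclidean_inner[symmetric])
  qed
  \<comment> \<open>The reciprocal is written as a power with exponent -1 and the norm as a power of
    \<open>y \<bullet> y\<close>, so that \<open>Ck_on_powr\<close> covers both; the norm itself
    would need its own derivative.\<close>
  have "Ck_on k (- {0 :: 'a})
     (\<lambda>y. (1 - s) * ((c + d * ((1 + (y \<bullet> \<nu>) * (y \<bullet> \<nu>)) powr (-1)))
        * ((y \<bullet> y) powr (- (real DIM('a) + 2 * s) / 2))))"
    by (intro Ck_on_const Ck_on_add Ck_on_mult Ck_on_inner op Ck_on_powr sq)
      (auto simp: add_pos_nonneg)
  then show ?thesis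
  proof (rule Ck_on_cong[OF op, rotated])
    fix y :: 'a assume "y \<in> - {0}"
    have "1 + (y \<bullet> \<nu>) * (y \<bullet> \<nu>) > 0" by (simp add: add_pos_nonneg)
    then have 1: "(1 + (y \<bullet> \<nu>) * (y \<bullet> \<nu>)) powr (-1) = 1 / (1 + (y \<bullet> \<nu>)\<^sup>2)"
      by (simp add: powr_minus_divide power2_eq_square)
    have 2: "(y \<bullet> y) powr (- (real DIM('a) + 2 * s) / 2) = norm y powr (- (real DIM('a) + 2 * s))"
      using powr_powr[of "y \<bullet> y" "1/2" "- (real DIM('a) + 2 * s)"]
      by (simp add: norm_eq_sqrt_inner powr_half_sqrt)
    show "(1 - s) * ((c + d * ((1 + (y \<bullet> \<nu>) * (y \<bullet> \<nu>)) powr (-1)))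
        * ((y \<bullet> y) powr (- (real DIM('a) + 2 * s) / 2))) =
        kernel s (\<lambda>y. c + d * (1 / (1 + (y \<bullet> \<nu>)\<^sup>2))) y"
      unfolding kernel_def 1 2 by (simp only: powr_minus divide_inverse mult_ac)
  qed
qed

text \<open>The variable \<open>t\<close> of the assumption stands for the value of
  \<open>1 / (1 + (y \<bullet> \<nu>)\<^sup>2)\<close>, which lies between 0 and 1.\<close>

lemma admissible_ridge:
  fixes \<nu> :: "'a::euclidean_space"
  assumes "\<And>t. 0 \<le> t \<Longrightarrow> t \<le> 1 \<Longrightarrow> lam \<le> c + d * t \<and> c + d * t \<le> Lam"
  shows "admissible lam Lam (\<lambda>y. c + d * (1 / (1 + (y \<bullet> \<nu>)\<^sup>2)))"
  using assms by (auto simp: admissible_def add_pos_nonneg simp del: times_divide_eq_right)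

lemma integro_op_ridge_mem:
  fixes \<nu> :: "'a::euclidean_space"
  assumes "\<L> \<in> {class_L0 s lam Lam, class_L1 s lam Lam, class_L2 s lam Lam}"
    and "\<And>t. 0 \<le> t \<Longrightarrow> t \<le> 1 \<Longrightarrow> lam \<le> c + d * t \<and> c + d * t \<le> Lam"
  shows "integro_op s (\<lambda>y. c + d * (1 / (1 + (y \<bullet> \<nu>)\<^sup>2))) \<in> \<L>"
  using assms(1) admissible_ridge[OF assms(2), where \<nu> = \<nu>] Ck_on_kernel_ridge[of _ s c d \<nu>]
  unfolding class_L0_def class_L1_def class_L2_def by blast

section \<open>Kernels depending on one direction\<close>

lemma nn_integral_lborel_scale:
  fixes f :: "'a::euclidean_space \<Rightarrow> ennreal"
  assumes [measurable]: "f \<in> borel_measurable borel" and "0 < r"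
  shows "(\<integral>\<^sup>+y. f y \<partial>lborel) = ennreal (r ^ DIM('a)) * (\<integral>\<^sup>+z. f (r *\<^sub>R z) \<partial>lborel)"
  using assms(2)
  by (subst lborel_affine[of r 0])
    (auto simp: nn_integral_density nn_integral_distr nn_integral_cmult)

lemma nn_integral_scale_Ioi:
  fixes h :: "real \<Rightarrow> ennreal"
  assumes [measurable]: "h \<in> borel_measurable borel" and "0 < r"
  shows "(\<integral>\<^sup>+t. indicator {0<..} t * h t \<partial>lborel) =
    ennreal r * (\<integral>\<^sup>+t. indicator {0<..} t * h (r * t) \<partial>lborel)"
proof -
  have "indicator {0<..} (r * t) = (indicator {0<..} t :: ennreal)" for t
    using assms(2) by (auto simp: indicator_def zero_less_mult_iff)
  then show ?thesis
    using nn_integral_lborel_scale[of "\<lambda>t. indicator {0<..} t * h t" r] assms(2) by simp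
qed

text \<open>Inserting a constant in the form \<open>\<integral> 1[N/2, N](r) dr / r\<close>, exchanging the integrals and
  rescaling \<open>y = r z\<close> separates the radial variable without polar coordinates.\<close>

lemma log_window_integral:
  assumes "0 < N"
  shows "(\<integral>\<^sup>+r. indicator {0<..} r * (indicator {N/2..N} r * ennreal (1/r)) \<partial>lborel) =
    (\<integral>\<^sup>+r. indicator {0<..} r * (indicator {1/2..1} r * ennreal (1/r)) \<partial>lborel)" (is "?L = ?R")
proof -
  have "?L = ennreal N * (\<integral>\<^sup>+r. indicator {0<..} r *
      (indicator {N/2..N} (N * r) * ennreal (1/(N * r))) \<partial>lborel)"
    by (rule nn_integral_scale_Ioi) (use assms in auto)
  also have "\<dots> = (\<integral>\<^sup>+r. ennreal N * (indicator {0<..} r *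
      (indicator {N/2..N} (N * r) * ennreal (1/(N * r)))) \<partial>lborel)"
    by (subst nn_integral_cmult) auto
  also have "\<dots> = ?R"
  proof (rule nn_integral_cong)
    fix r :: real
    show "ennreal N * (indicator {0<..} r * (indicator {N/2..N} (N * r) * ennreal (1/(N * r)))) =
      indicator {0<..} r * (indicator {1/2..1} r * ennreal (1/r))"
      using assms by (auto simp: indicator_def ennreal_mult[symmetric])
  qed
  finally show ?thesis .
qed

lemma log_window_bounds:
  "(\<integral>\<^sup>+r. indicator {0<..} r * (indicator {1/2..1} r * ennreal (1/r)) \<partial>lborel) \<noteq> 0" (is "?k \<noteq> 0")
  "(\<integral>\<^sup>+r. indicator {0<..} r * (indicator {1/2..1} r * ennreal (1/r)) \<partial>lborel) \<noteq> \<infinity>"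
proof -
  have "(\<integral>\<^sup>+r. indicator {1/2..1::real} r \<partial>lborel) \<le> ?k"
    by (rule nn_integral_mono) (auto simp: indicator_def)
  then show "?k \<noteq> 0" by auto
  have "?k \<le> (\<integral>\<^sup>+r. ennreal 2 * indicator {1/2..1::real} r \<partial>lborel)"
    by (rule nn_integral_mono)
      (auto simp: indicator_def divide_simps simp flip: ennreal_numeral intro!: ennreal_leI)
  also have "\<dots> = ennreal 2 * emeasure lborel {1/2..1::real}"
    by (rule nn_integral_cmult_indicator) simp
  also have "\<dots> < \<infinity>"
    using emeasure_compact_finite[of "{1/2..1::real}"]
    by (simp add: ennreal_mult_less_top)
  finally show "?k \<noteq> \<infinity>" by simp
qed

text \<open>Homogeneity of \<open>t powr (-1-p)\<close> under the substitution t = |a| r; evenness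
  removes the sign of \<open>a\<close>. For a = 0 both sides vanish, by \<open>G 0 = 0\<close> and
  \<open>0 powr p = 0\<close>.\<close>

lemma nn_integral_even_scale:
  fixes G :: "real \<Rightarrow> ennreal"
  assumes [measurable]: "G \<in> borel_measurable borel"
    and even: "\<And>t. G (- t) = G t" and G0: "G 0 = 0"
  shows "(\<integral>\<^sup>+r. indicator {0<..} r * (G (r * a) * ennreal (r powr (-1-p))) \<partial>lborel) =
    ennreal (\<bar>a\<bar> powr p) * (\<integral>\<^sup>+t. indicator {0<..} t * (G t * ennreal (t powr (-1-p))) \<partial>lborel)"
proof (cases "a = 0")
  case True
  then show ?thesis by (simp add: G0)
next
  case False
  then have a: "\<bar>a\<bar> > 0" by simp
  have eq: "G (r * a) = G (\<bar>a\<bar> * r)" for r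
    using even[of "r * a"] by (cases "a \<ge> 0") (auto simp: mult.commute)
  have pw: "ennreal (\<bar>a\<bar> powr p) * (ennreal \<bar>a\<bar> * (indicator {0<..} t *
      (G (\<bar>a\<bar> * t) * ennreal ((\<bar>a\<bar> * t) powr (-1-p))))) =
      indicator {0<..} t * (G (t * a) * ennreal (t powr (-1-p)))" for t
  proof (cases "t > 0")
    case True
    have "\<bar>a\<bar> powr p * \<bar>a\<bar> * (\<bar>a\<bar> * t) powr (-1-p) = t powr (-1-p)"
      using a True powr_add[of "\<bar>a\<bar>" p 1] powr_add[of "\<bar>a\<bar>" "p+1" "-1-p"]
      by (simp add: powr_mult)
    then have "ennreal (\<bar>a\<bar> powr p) * (ennreal \<bar>a\<bar> * ennreal ((\<bar>a\<bar> * t) powr (-1-p))) =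
        ennreal (t powr (-1-p))"
      by (simp add: ennreal_mult[symmetric] mult.assoc)
    then have "(ennreal (\<bar>a\<bar> powr p) * (ennreal \<bar>a\<bar> * ennreal ((\<bar>a\<bar> * t) powr (-1-p)))) * G (\<bar>a\<bar> * t) =
        ennreal (t powr (-1-p)) * G (\<bar>a\<bar> * t)"
      by (rule arg_cong)
    then show ?thesis using True unfolding eq[of t]
      by (simp only: mult_ac) simp
  qed simp
  have "ennreal (\<bar>a\<bar> powr p) * (\<integral>\<^sup>+t. indicator {0<..} t * (G t * ennreal (t powr (-1-p))) \<partial>lborel)
     = ennreal (\<bar>a\<bar> powr p) * (ennreal \<bar>a\<bar> * (\<integral>\<^sup>+t. indicator {0<..} t *
        (G (\<bar>a\<bar> * t) * ennreal ((\<bar>a\<bar> * t) powr (-1-p))) \<partial>lborel))"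
    by (subst nn_integral_scale_Ioi[OF _ a]) auto
  also have "\<dots> = (\<integral>\<^sup>+t. ennreal (\<bar>a\<bar> powr p) * (ennreal \<bar>a\<bar> * (indicator {0<..} t *
        (G (\<bar>a\<bar> * t) * ennreal ((\<bar>a\<bar> * t) powr (-1-p))))) \<partial>lborel)"
    by (simp add: nn_integral_cmult)
  also have "\<dots> = (\<integral>\<^sup>+r. indicator {0<..} r * (G (r * a) * ennreal (r powr (-1-p))) \<partial>lborel)"
    by (simp only: pw)
  finally show ?thesis ..
qed

text \<open>What is left of the kernel in z after y = r z has turned the logarithmic window in r
  into an annulus. It is bounded and supported away from the origin, so its moments are finite
  although the kernel itself is not integrable.\<close>

definition annulus_weight :: "real \<Rightarrow> 'a::euclidean_space \<Rightarrow> ennreal" where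
  "annulus_weight p z = indicator {1..2} (norm z) * ennreal (norm z powr (- (real DIM('a) + p)))"

lemma annulus_weight_measurable [measurable]: "annulus_weight p \<in> borel_measurable borel"
  unfolding annulus_weight_def by measurable

lemma annulus_moment_bounds:
  fixes \<nu> :: "'a::euclidean_space"
  assumes "norm \<nu> = 1" "0 < p"
  shows "(\<integral>\<^sup>+z. annulus_weight p z * ennreal (\<bar>z \<bullet> \<nu>\<bar> powr p) \<partial>lborel) \<noteq> 0" (is "?A \<noteq> 0")
    and "(\<integral>\<^sup>+z. annulus_weight p z * ennreal (\<bar>z \<bullet> \<nu>\<bar> powr p) \<partial>lborel) \<noteq> \<infinity>"
proof -
  show "?A \<noteq> 0"
  proof
    assume "?A = 0"
    then have "AE z in lborel. annulus_weight p z * ennreal (\<bar>z \<bullet> \<nu>\<bar> powr p) = 0"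
      by (subst (asm) nn_integral_0_iff_AE) auto
    \<comment> \<open>The ball of radius 1/4 about (3/2) \<open>\<nu>\<close> stays inside the
      annulus and inside the half-space \<open>z \<bullet> \<nu> > 0\<close>, so the integrand is
      positive on a set of positive measure.\<close>
    moreover have "annulus_weight p z * ennreal (\<bar>z \<bullet> \<nu>\<bar> powr p) \<noteq> 0"
      if "z \<in> ball ((3/2) *\<^sub>R \<nu>) (1/4)" for z
    proof -
      define w where "w = z - (3/2) *\<^sub>R \<nu>"
      have w: "norm w < 1/4" using that by (simp add: w_def dist_norm norm_minus_commute)
      have z: "z = (3/2) *\<^sub>R \<nu> + w" by (simp add: w_def)
      have n: "norm ((3/2) *\<^sub>R \<nu>) = 3/2" using assms by simp
      have "norm z \<le> 3/2 + 1/4"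
        using norm_triangle_ineq[of "(3/2) *\<^sub>R \<nu>" w] w n unfolding z[symmetric] by linarith
      moreover have "norm z \<ge> 3/2 - 1/4"
        using norm_triangle_ineq4[of z w] w n z by simp
      moreover have "z \<bullet> \<nu> > 0"
      proof -
        have "\<bar>w \<bullet> \<nu>\<bar> < 1/4" using Cauchy_Schwarz_ineq2[of w \<nu>] w assms by simp
        moreover have "\<nu> \<bullet> \<nu> = 1" using assms by (simp add: norm_eq_1)
        ultimately show ?thesis by (simp add: z inner_add_left)
      qed
      ultimately show ?thesis by (auto simp: annulus_weight_def)
    qed
    ultimately have "AE z in lborel. z \<notin> ball ((3/2) *\<^sub>R \<nu>) (1/4)"
      by (auto elim!: eventually_mono)
    then have "ball ((3/2) *\<^sub>R \<nu>) (1/4) \<in> null_sets lborel"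
      by (subst AE_iff_null_sets) auto
    then have "ball ((3/2) *\<^sub>R \<nu>) (1/4) = {}"
      using open_not_negligible[of "ball ((3/2) *\<^sub>R \<nu>) (1/4)"]
      by (auto simp: negligible_iff_null_sets null_sets_completionI)
    then show False by simp
  qed
  have "?A \<le> (\<integral>\<^sup>+z. ennreal (2 powr p) * indicator (cball (0::'a) 2) z \<partial>lborel)"
  proof (rule nn_integral_mono)
    fix z :: 'a
    show "annulus_weight p z * ennreal (\<bar>z \<bullet> \<nu>\<bar> powr p) \<le>
        ennreal (2 powr p) * indicator (cball 0 2) z"
    proof (cases "norm z \<in> {1..2}")
      case True
      have "\<bar>z \<bullet> \<nu>\<bar> \<le> 2" using Cauchy_Schwarz_ineq2[of z \<nu>] True assms by simp
      then have 1: "\<bar>z \<bullet> \<nu>\<bar> powr p \<le> 2 powr p" using assms by (intro powr_mono2) auto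
      have 2: "norm z powr (- (real DIM('a) + p)) \<le> 1"
        using True assms powr_mono[of "- (real DIM('a) + p)" 0 "norm z"] by (auto split: if_splits)
      have "norm z powr (- (real DIM('a) + p)) * \<bar>z \<bullet> \<nu>\<bar> powr p \<le> 1 * 2 powr p"
        by (rule mult_mono[OF 2 1]) auto
      then show ?thesis using True
        by (simp add: annulus_weight_def ennreal_mult[symmetric] ennreal_leI)
    qed (simp add: annulus_weight_def)
  qed
  also have "\<dots> < \<infinity>"
    using emeasure_lborel_cball_finite[of "0::'a" 2]
    by (subst nn_integral_cmult_indicator) (auto simp: ennreal_mult_less_top)
  finally show "?A \<noteq> \<infinity>" by simp
qed

text \<open>Kept as an identity of products in \<open>ennreal\<close>: the integrals may be
  exchanged without any integrability, and the division by the window constant is postponed until it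
  is known to be positive and finite.\<close>

lemma nn_integral_ridge_kernel:
  fixes \<nu> :: "'a::euclidean_space"
  assumes [measurable]: "G \<in> borel_measurable borel"
    and even: "\<And>t. G (- t) = G t" and G0: "G 0 = 0"
  shows "(\<integral>\<^sup>+r. indicator {0<..} r * (indicator {1/2..1} r * ennreal (1/r)) \<partial>lborel) *
      (\<integral>\<^sup>+y. G (y \<bullet> \<nu>) * ennreal (norm y powr (- (real DIM('a) + p))) \<partial>lborel) =
    (\<integral>\<^sup>+z. annulus_weight p z * ennreal (\<bar>z \<bullet> \<nu>\<bar> powr p) \<partial>(lborel :: 'a measure)) *
      (\<integral>\<^sup>+t. indicator {0<..} t * (G t * ennreal (t powr (-1-p))) \<partial>lborel)"
    (is "?k * (\<integral>\<^sup>+y. ?F y \<partial>lborel) = ?A * ?I")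
proof -
  \<comment> \<open>Under y = r z the condition norm y / 2 <= r <= norm y becomes 1 <= norm z <= 2,
    which no longer involves r. The rewriting below as a condition on y serves
    measurability.\<close>
  let ?W = "\<lambda>(y :: 'a) (r :: real). indicator {0<..} r * (indicator {norm y / 2..norm y} r * ennreal (1/r))
      :: ennreal"
  have W: "?W y r = indicator {0<..} r *
      ((if norm y / 2 \<le> r \<and> r \<le> norm y then 1 else 0) * ennreal (1/r))" for y :: 'a and r
    by (simp add: indicator_def)
  have [measurable]: "(\<lambda>y. ?W (c *\<^sub>R y) r) \<in> borel_measurable borel" for c r
    unfolding W by measurable
  have [measurable]: "(\<lambda>y. ?W y r) \<in> borel_measurable borel" for r
    unfolding W by measurable
  have "?k * (\<integral>\<^sup>+y. ?F y \<partial>lborel) = (\<integral>\<^sup>+y. ?k * ?F y \<partial>lborel)"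
    by (subst nn_integral_cmult) auto
  also have "\<dots> = (\<integral>\<^sup>+y. (\<integral>\<^sup>+r. ?W y r * ?F y \<partial>lborel) \<partial>lborel)"
  proof (rule nn_integral_cong)
    fix y :: 'a
    show "?k * ?F y = (\<integral>\<^sup>+r. ?W y r * ?F y \<partial>lborel)"
    \<comment> \<open>At y = 0 the window is empty and the constant cannot be inserted; there
      \<open>G 0 = 0\<close> makes both sides vanish.\<close>
    proof (cases "y = 0")
      case False
      then have "?k = (\<integral>\<^sup>+r. ?W y r \<partial>lborel)"
        using log_window_integral[of "norm y"] by simp
      then show ?thesis by (simp only:) (rule nn_integral_multc[symmetric], measurable)
    qed (simp add: G0)
  qed
  also have "\<dots> = (\<integral>\<^sup>+r. (\<integral>\<^sup>+y. ?W y r * ?F y \<partial>lborel) \<partial>lborel)"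
    unfolding W by (rule lborel_pair.Fubini') (unfold case_prod_beta', measurable)
  also have "\<dots> = (\<integral>\<^sup>+r. (\<integral>\<^sup>+z. annulus_weight p z *
      (indicator {0<..} r * (G (r * (z \<bullet> \<nu>)) * ennreal (r powr (-1-p)))) \<partial>(lborel :: 'a measure)) \<partial>lborel)"
  proof (rule nn_integral_cong)
    fix r :: real
    show "(\<integral>\<^sup>+y. ?W y r * ?F y \<partial>lborel) = (\<integral>\<^sup>+z. annulus_weight p z *
      (indicator {0<..} r * (G (r * (z \<bullet> \<nu>)) * ennreal (r powr (-1-p)))) \<partial>(lborel :: 'a measure))"
    proof (cases "r > 0")
      case True
      have *: "ennreal (r ^ DIM('a)) * (?W (r *\<^sub>R z) r * ?F (r *\<^sub>R z)) = annulus_weight p z *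
          (indicator {0<..} r * (G (r * (z \<bullet> \<nu>)) * ennreal (r powr (-1-p))))" for z :: 'a
      proof -
        have ind: "indicator {norm (r *\<^sub>R z) / 2..norm (r *\<^sub>R z)} r = (indicator {1..2} (norm z) :: ennreal)"
          using True by (auto simp: indicator_def)
        have "r ^ DIM('a) * ((1/r) * norm (r *\<^sub>R z) powr (- (real DIM('a) + p))) =
            norm z powr (- (real DIM('a) + p)) * r powr (-1-p)"
        proof -
          have "r powr (real DIM('a)) * r powr (-1) * r powr (- (real DIM('a) + p)) = r powr (-1-p)"
            by (simp only: powr_add[symmetric]) (simp add: algebra_simps)
          then have "r ^ DIM('a) * (1/r) * r powr (- (real DIM('a) + p)) = r powr (-1-p)"
            using True by (simp only: powr_realpow powr_minus_divide powr_one)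
          from arg_cong[OF this, of "\<lambda>q. norm z powr (- (real DIM('a) + p)) * q"]
          show ?thesis using True by (simp add: powr_mult mult_ac)
        qed
        then have "ennreal (r ^ DIM('a)) * (ennreal (1/r) *
            ennreal (norm (r *\<^sub>R z) powr (- (real DIM('a) + p)))) =
            ennreal (norm z powr (- (real DIM('a) + p))) * ennreal (r powr (-1-p))"
          using True by (simp add: ennreal_mult[symmetric])
        from arg_cong[OF this, of "\<lambda>q. G (r * (z \<bullet> \<nu>)) * (indicator {1..2} (norm z) * q)"]
        show ?thesis using True
          unfolding annulus_weight_def ind inner_scaleR_left
          by (simp add: mult_ac)
      qed
      have "(\<integral>\<^sup>+y. ?W y r * ?F y \<partial>lborel) =
          ennreal (r ^ DIM('a)) * (\<integral>\<^sup>+z. ?W (r *\<^sub>R z) r * ?F (r *\<^sub>R z) \<partial>(lborel :: 'a measure))"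
        by (rule nn_integral_lborel_scale[OF _ True]) measurable
      also have "\<dots> = (\<integral>\<^sup>+z. ennreal (r ^ DIM('a)) * (?W (r *\<^sub>R z) r * ?F (r *\<^sub>R z)) \<partial>(lborel :: 'a measure))"
        by (rule nn_integral_cmult[symmetric]) measurable
      finally show ?thesis by (simp only: *)
    qed simp
  qed
  also have "\<dots> = (\<integral>\<^sup>+z. (\<integral>\<^sup>+r. annulus_weight p z *
      (indicator {0<..} r * (G (r * (z \<bullet> \<nu>)) * ennreal (r powr (-1-p)))) \<partial>lborel) \<partial>(lborel :: 'a measure))"
    by (rule lborel_pair.Fubini'[symmetric]) (simp add: case_prod_beta')
  also have "\<dots> = (\<integral>\<^sup>+z. annulus_weight p z * ennreal (\<bar>z \<bullet> \<nu>\<bar> powr p) * ?I \<partial>(lborel :: 'a measure))"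
    by (subst nn_integral_cmult)
      (auto simp: nn_integral_even_scale[OF assms] mult.assoc)
  also have "\<dots> = ?A * ?I" by (subst nn_integral_multc) auto
  finally show ?thesis .
qed

text \<open>The constant is the annulus moment divided by the window constant. It is fixed before
  \<open>G\<close>, so one \<open>C\<close> serves all exponents and all weights.\<close>

lemma integral_ridge_kernel:
  fixes \<nu> :: "'a::euclidean_space"
  assumes "norm \<nu> = 1" "0 < p"
  obtains C where "0 < C"
    and "\<And>G. G \<in> borel_measurable borel \<Longrightarrow> (\<And>t. G (- t) = G t) \<Longrightarrow> G 0 = (0::real) \<Longrightarrow>
      integrable lborel (\<lambda>t. indicator {0<..} t * (G t * t powr (-1-p))) \<Longrightarrow>
      (LINT y|lborel. G (y \<bullet> \<nu>) * norm y powr (- (real DIM('a) + p))) =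
      C * (LINT t|lborel. indicator {0<..} t * (G t * t powr (-1-p)))"
proof -
  define k where
    "k = (\<integral>\<^sup>+r. indicator {0<..} r * (indicator {1/2..1} r * ennreal (1/r)) \<partial>lborel)"
  define A where "A = (\<integral>\<^sup>+z. annulus_weight p z * ennreal (\<bar>z \<bullet> \<nu>\<bar> powr p) \<partial>(lborel :: 'a measure))"
  obtain k' where k': "k = ennreal k'" "0 < k'"
    using log_window_bounds unfolding k_def[symmetric]
    by (cases k) (auto simp: less_le)
  obtain A' where A': "A = ennreal A'" "0 < A'"
    using annulus_moment_bounds[OF assms] unfolding A_def[symmetric]
    by (cases A) (auto simp: less_le)
  define C where "C = A' / k'"
  have C: "0 < C" using k' A' by (simp add: C_def)
  have nn: "(\<integral>\<^sup>+y. H (y \<bullet> \<nu>) * ennreal (norm y powr (- (real DIM('a) + p))) \<partial>lborel) =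
      ennreal C * (\<integral>\<^sup>+t. indicator {0<..} t * (H t * ennreal (t powr (-1-p))) \<partial>lborel)" (is "?X = _ * ?I")
    if "H \<in> borel_measurable borel" "\<And>t. H (- t) = H t" "H 0 = 0" for H
  proof -
    have "ennreal k' * ?X = ennreal A' * ?I"
      using nn_integral_ridge_kernel[OF that, of \<nu> p] unfolding k_def[symmetric] A_def[symmetric] k' A' .
    then have "ennreal (1/k') * (ennreal k' * ?X) = ennreal (1/k') * (ennreal A' * ?I)" by simp
    then show ?thesis
      using k' A' by (simp add: C_def mult.assoc[symmetric] ennreal_mult[symmetric])
  qed
  show thesis
  proof (rule that[OF C])
    fix G :: "real \<Rightarrow> real"
    assume [measurable]: "G \<in> borel_measurable borel" and even: "\<And>t. G (- t) = G t" and G0: "G 0 = 0"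
      and int: "integrable lborel (\<lambda>t. indicator {0<..} t * (G t * t powr (-1-p)))"
    let ?f = "\<lambda>y::'a. G (y \<bullet> \<nu>) * norm y powr (- (real DIM('a) + p))"
    let ?g = "\<lambda>t. indicator {0<..} t * (G t * t powr (-1-p))"
    have e1: "ennreal (a * norm y powr q) = ennreal a * ennreal (norm y powr q)" for a q and y :: 'a
      by (rule ennreal_mult'') simp
    have e2: "ennreal (indicator {0<..} t * (a * t powr q)) =
        indicator {0<..} t * (ennreal a * ennreal (t powr q))" for a t q :: real
      by (simp add: indicator_def ennreal_mult'')
    have n1: "- (G u * x) = (- G u) * x" and n2: "- (c * (G u * x)) = c * ((- G u) * x)" for u x c
      by simp_all
    \<comment> \<open>Since \<open>ennreal\<close> sends negative reals to 0,
      \<open>ennreal (G t)\<close> and \<open>ennreal (- G t)\<close> are the positive and negative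
      parts of \<open>G\<close>; both are again even and vanish at 0.\<close>
    have pos: "(\<integral>\<^sup>+y. ennreal (?f y) \<partial>lborel) = ennreal C * (\<integral>\<^sup>+t. ennreal (?g t) \<partial>lborel)"
      unfolding e1 e2 by (rule nn) (auto simp: even G0)
    have neg: "(\<integral>\<^sup>+y. ennreal (- ?f y) \<partial>lborel) = ennreal C * (\<integral>\<^sup>+t. ennreal (- ?g t) \<partial>lborel)"
      unfolding n1 n2 e1 e2 by (rule nn[of "\<lambda>t. ennreal (- G t)"]) (auto simp: even G0)
    have fin: "(\<integral>\<^sup>+t. ennreal (?g t) \<partial>lborel) \<noteq> \<infinity>" "(\<integral>\<^sup>+t. ennreal (- ?g t) \<partial>lborel) \<noteq> \<infinity>"
      using int unfolding real_integrable_def by auto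
    have "integrable lborel ?f"
      unfolding real_integrable_def pos neg using fin
      by (auto simp: ennreal_mult_eq_top_iff)
    then have "(LINT y|lborel. ?f y) = enn2real (\<integral>\<^sup>+y. ennreal (?f y) \<partial>lborel) -
        enn2real (\<integral>\<^sup>+y. ennreal (- ?f y) \<partial>lborel)"
      by (rule real_lebesgue_integral_def)
    then show "(LINT y|lborel. ?f y) = C * (LINT t|lborel. ?g t)"
      using C unfolding real_lebesgue_integral_def[OF int]
      unfolding pos neg by (simp add: enn2real_mult right_diff_distrib)
  qed
qed

section \<open>The one-dimensional second difference\<close>

text \<open>The function delta of the introduction: the symmetric difference of
  \<open>pos_power \<beta> \<nu>\<close> at the point \<open>\<nu>\<close> in a direction y with
  \<open>y \<bullet> \<nu> = t\<close>, for a unit vector \<open>\<nu>\<close>.\<close>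

definition second_diff :: "real \<Rightarrow> real \<Rightarrow> real" where
  "second_diff \<beta> t = (max 0 (1 + t) powr \<beta> + max 0 (1 - t) powr \<beta>) / 2 - 1"

lemma second_diff_minus: "second_diff \<beta> (- t) = second_diff \<beta> t"
  by (simp add: second_diff_def add.commute)

lemma second_diff_0: "second_diff \<beta> 0 = 0"
  by (simp add: second_diff_def)

lemma second_diff_measurable [measurable]: "second_diff \<beta> \<in> borel_measurable borel"
  unfolding second_diff_def by measurable

lemma second_diff_inside: "0 \<le> t \<Longrightarrow> t \<le> 1 \<Longrightarrow>
    second_diff \<beta> t = ((1 + t) powr \<beta> + (1 - t) powr \<beta>) / 2 - 1"
  by (simp add: second_diff_def)

lemma second_diff_outside: "1 \<le> t \<Longrightarrow> second_diff \<beta> t = (1 + t) powr \<beta> / 2 - 1"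
  by (simp add: second_diff_def)

text \<open>Concavity: the graph lies below its tangent at a = 1. This is Young's inequality with
  second factor 1, apart from a = 0.\<close>

lemma powr_le_affine:
  fixes a q :: real
  assumes "0 \<le> a" "0 \<le> q" "q \<le> 1"
  shows "a powr q \<le> 1 + q * (a - 1)"
proof (cases "a = 0")
  case False
  then show ?thesis
    using Youngs_inequality_0[of q "1 - q" a 1] assms by (simp add: algebra_simps)
qed (use assms in simp)

text \<open>The convex counterpart, from the concave case applied to \<open>a powr q\<close> with
  exponent 1/q.\<close>

lemma powr_ge_affine:
  fixes a q :: real
  assumes "0 \<le> a" "1 \<le> q"
  shows "1 + q * (a - 1) \<le> a powr q"
proof -
  have "(a powr q) powr (1/q) \<le> 1 + (1/q) * (a powr q - 1)"
    by (rule powr_le_affine) (use assms in auto)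
  then have "a \<le> 1 + (1/q) * (a powr q - 1)"
    using assms by (simp add: powr_powr)
  then have "q * a \<le> q * (1 + (1/q) * (a powr q - 1))"
    using assms by (intro mult_left_mono) auto
  then show ?thesis using assms by (simp add: algebra_simps)
qed

text \<open>Quadratic decay at 0 is what beats the singularity of the kernel. Upper bound: write
  a^\<beta> as (a^2)^(\<beta>/2) and use the tangent at a^2 = 1; the linear terms cancel because
  (1+t)^2 + (1-t)^2 - 2 = 2 t^2. Lower bound: by the arithmetic-geometric mean inequality the
  average is at least (1-t^2)^(\<beta>/2), hence at least 1-t^2. Both use only \<beta>/2 <= 1, so no
  case distinction at \<beta> = 1 arises.\<close>

lemma abs_second_diff_inside:
  assumes "0 < \<beta>" "\<beta> < 2" "0 \<le> t" "t \<le> 1"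
  shows "\<bar>second_diff \<beta> t\<bar> \<le> t\<^sup>2"
proof -
  have sq: "a powr \<beta> = (a\<^sup>2) powr (\<beta>/2)" if "0 \<le> a" for a :: real
    using that by (cases "a = 0") (simp_all add: powr_powr flip: powr_numeral)
  have up: "a powr \<beta> \<le> 1 + \<beta>/2 * (a\<^sup>2 - 1)" if "0 \<le> a" for a :: real
    unfolding sq[OF that] by (rule powr_le_affine) (use assms in auto)
  have "second_diff \<beta> t \<le> \<beta>/2 * t\<^sup>2"
    using up[of "1 + t"] up[of "1 - t"] assms
    by (simp add: second_diff_inside power2_eq_square algebra_simps)
  also have "\<dots> \<le> 1 * t\<^sup>2" using assms by (intro mult_right_mono) auto
  finally have u: "second_diff \<beta> t \<le> t\<^sup>2" by simp
  define a b where "a = (1 + t) powr (\<beta>/2)" and "b = (1 - t) powr (\<beta>/2)"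
  have "t\<^sup>2 \<le> 1" using assms by (simp add: power_le_one)
  then have "(1 - t\<^sup>2) powr 1 \<le> (1 - t\<^sup>2) powr (\<beta>/2)"
    using assms by (intro powr_mono') auto
  then have "1 - t\<^sup>2 \<le> (1 - t\<^sup>2) powr (\<beta>/2)" using \<open>t\<^sup>2 \<le> 1\<close> by simp
  also have "1 - t\<^sup>2 = (1 + t) * (1 - t)" by (simp add: power2_eq_square algebra_simps)
  also have "\<dots> powr (\<beta>/2) = a * b" using assms by (simp add: powr_mult a_def b_def)
  also have "\<dots> \<le> (a\<^sup>2 + b\<^sup>2) / 2"
    using zero_le_power2[of "a - b"] by (simp add: power2_eq_square algebra_simps)
  also have "\<dots> = second_diff \<beta> t + 1"
    using assms powr_add[of "1 + t" "\<beta>/2" "\<beta>/2"] powr_add[of "1 - t" "\<beta>/2" "\<beta>/2"]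
    by (simp add: second_diff_inside a_def b_def power2_eq_square)
  finally have "- t\<^sup>2 \<le> second_diff \<beta> t" by (simp add: power2_eq_square algebra_simps)
  with u show ?thesis by simp
qed

lemma abs_second_diff_outside:
  assumes "0 < \<beta>" "\<beta> < 2" "1 \<le> t"
  shows "\<bar>second_diff \<beta> t\<bar> \<le> 2 * t powr \<beta>"
proof -
  have "(1 + t) powr \<beta> \<le> (2 * t) powr \<beta>" using assms by (intro powr_mono2) auto
  also have "\<dots> = 2 powr \<beta> * t powr \<beta>" using assms by (simp add: powr_mult)
  also have "\<dots> \<le> 2 powr 2 * t powr \<beta>" using assms by (intro mult_right_mono powr_mono) auto
  finally have "(1 + t) powr \<beta> \<le> 4 * t powr \<beta>" by simp
  moreover have "1 \<le> t powr \<beta>" using assms by (simp add: ge_one_powr_ge_zero)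
  moreover have "0 \<le> (1 + t) powr \<beta>" by simp
  ultimately show ?thesis using assms
    unfolding second_diff_outside[OF assms(3)] by linarith
qed

text \<open>For \<beta> >= 1 convexity gives a nonnegative function and the crossing sits at 0. For
  \<beta> < 1 concavity gives a nonpositive function on [0, 1], which then increases. Strict
  positivity is claimed only beyond 1, since for \<beta> = 1 the function is identically 0 on
  [0, 1].\<close>

lemma second_diff_single_crossing:
  assumes "0 < \<beta>"
  obtains t\<^sub>0 where "0 \<le> t\<^sub>0"
    and "\<And>t. 0 \<le> t \<Longrightarrow> t \<le> t\<^sub>0 \<Longrightarrow> second_diff \<beta> t \<le> 0"
    and "\<And>t. t\<^sub>0 \<le> t \<Longrightarrow> 0 \<le> second_diff \<beta> t"
    and "\<And>t. t\<^sub>0 < t \<Longrightarrow> 1 < t \<Longrightarrow> 0 < second_diff \<beta> t"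
proof (cases "1 \<le> \<beta>")
  case True
  have out: "0 < second_diff \<beta> t" if "1 < t" for t
  proof -
    have "2 < (1 + t) powr 1" using that by simp
    also have "\<dots> \<le> (1 + t) powr \<beta>" using that True by (intro powr_mono) auto
    finally show ?thesis using that by (simp add: second_diff_outside)
  qed
  have "0 \<le> second_diff \<beta> t" if "0 \<le> t" "t \<le> 1" for t
    using powr_ge_affine[of "1 + t" \<beta>] powr_ge_affine[of "1 - t" \<beta>] that True
    by (simp add: second_diff_inside)
  with out have "0 \<le> second_diff \<beta> t" if "0 \<le> t" for t
    using that by (cases "t \<le> 1") (auto intro: less_imp_le)
  with out show thesis by (intro that[of 0]) (auto simp: second_diff_0)
next
  case False
  \<comment> \<open>The solution of (1+t)^\<beta> = 2, that is, the zero of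
    \<open>second_diff\<close> beyond 1.\<close>
  define t\<^sub>0 where "t\<^sub>0 = 2 powr (1/\<beta>) - 1"
  have "2 powr 1 < 2 powr (1/\<beta>)"
    using assms False by (intro powr_less_mono) auto
  then have t0: "1 < t\<^sub>0" by (simp add: t\<^sub>0_def)
  have e: "(1 + t\<^sub>0) powr \<beta> = 2" using assms by (simp add: t\<^sub>0_def powr_powr)
  show thesis
  proof (rule that)
    show "0 \<le> t\<^sub>0" using t0 by simp
    fix t
    show "second_diff \<beta> t \<le> 0" if "0 \<le> t" "t \<le> t\<^sub>0"
    proof (cases "t \<le> 1")
      case True
      then show ?thesis
        using powr_le_affine[of "1 + t" \<beta>] powr_le_affine[of "1 - t" \<beta>] that False assms
        by (simp add: second_diff_inside)
    next
      case F: False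
      have "(1 + t) powr \<beta> \<le> (1 + t\<^sub>0) powr \<beta>" using that F assms by (intro powr_mono2) auto
      then show ?thesis using F e by (simp add: second_diff_outside)
    qed
    show "0 \<le> second_diff \<beta> t" if "t\<^sub>0 \<le> t"
    proof -
      have "(1 + t\<^sub>0) powr \<beta> \<le> (1 + t) powr \<beta>" using that t0 assms by (intro powr_mono2) auto
      then show ?thesis using that t0 e by (simp add: second_diff_outside)
    qed
    show "0 < second_diff \<beta> t" if "t\<^sub>0 < t" "1 < t"
    proof -
      have "(1 + t\<^sub>0) powr \<beta> < (1 + t) powr \<beta>" using that t0 assms by (intro powr_less_mono2) auto
      then show ?thesis using that t0 e by (simp add: second_diff_outside)
    qed
  qed
qed

text \<open>The second claim gives the rate at which the piece removed by a cut-off at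
  \<open>c\<close> disappears.\<close>

lemma second_diff_integrable_inside:
  assumes "0 < \<beta>" "\<beta> < 2" "s < 1" "0 \<le> c" "c \<le> 1"
  shows "(\<lambda>t. second_diff \<beta> t * t powr (-1-2 * s)) absolutely_integrable_on {0..c}"
    and "\<bar>integral {0..c} (\<lambda>t. second_diff \<beta> t * t powr (-1-2 * s))\<bar> \<le> c powr (2-2 * s) / (2-2 * s)"
proof -
  have hi: "((\<lambda>t. t powr (1-2 * s)) has_integral (c powr (2-2 * s) / (2-2 * s))) {0..c}"
    using has_integral_powr_from_0[of "1-2 * s" c] assms by simp
  have bd: "norm (second_diff \<beta> t * t powr (-1-2 * s)) \<le> t powr (1-2 * s)" if "t \<in> {0..c}" for t
  proof (cases "t = 0")
    case False
    have "\<bar>second_diff \<beta> t\<bar> * t powr (-1-2 * s) \<le> t\<^sup>2 * t powr (-1-2 * s)"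
      using abs_second_diff_inside[of \<beta> t] assms that by (intro mult_right_mono) auto
    also have "t\<^sup>2 = t powr 2" using False that by (simp add: powr_numeral)
    also have "t powr 2 * t powr (-1-2 * s) = t powr (1-2 * s)" by (simp flip: powr_add)
    finally show ?thesis by (simp add: abs_mult)
  qed simp
  show ai: "(\<lambda>t. second_diff \<beta> t * t powr (-1-2 * s)) absolutely_integrable_on {0..c}"
    by (rule measurable_bounded_by_integrable_imp_absolutely_integrable[OF _ _ _ bd])
      (use hi in \<open>auto intro!: measurable_restrict_space1 measurable_completion\<close>)
  have "norm (integral {0..c} (\<lambda>t. second_diff \<beta> t * t powr (-1-2 * s))) \<le>
      integral {0..c} (\<lambda>t. t powr (1-2 * s))"
    by (rule integral_norm_bound_integral[OF _ _ bd])
      (use hi ai in \<open>auto simp: absolutely_integrable_on_def\<close>)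
  then show "\<bar>integral {0..c} (\<lambda>t. second_diff \<beta> t * t powr (-1-2 * s))\<bar> \<le> c powr (2-2 * s) / (2-2 * s)"
    using integral_unique[OF hi] by simp
qed

lemma second_diff_integrable_outside:
  assumes "0 < \<beta>" "\<beta> < 2 * s" "s < 1"
  shows "(\<lambda>t. second_diff \<beta> t * t powr (-1-2 * s)) absolutely_integrable_on {1..}"
proof -
  have "(\<lambda>t. t powr (\<beta>-1-2 * s)) integrable_on {1..}"
    using has_integral_powr_to_inf[of "\<beta>-1-2 * s" 1] assms by (auto simp: integrable_on_def)
  then have hi: "(\<lambda>t. 2 * t powr (\<beta>-1-2 * s)) integrable_on {1..}"
    by (rule integrable_on_mult_right)
  have bd: "norm (second_diff \<beta> t * t powr (-1-2 * s)) \<le> 2 * t powr (\<beta>-1-2 * s)" if "t \<in> {1..}" for t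
  proof -
    have "\<bar>second_diff \<beta> t\<bar> * t powr (-1-2 * s) \<le> 2 * t powr \<beta> * t powr (-1-2 * s)"
      using abs_second_diff_outside[of \<beta> t] assms that by (intro mult_right_mono) auto
    also have "\<dots> = 2 * t powr (\<beta> + (-1-2 * s))" by (simp only: powr_add mult.assoc)
    finally show ?thesis by (simp add: abs_mult algebra_simps)
  qed
  show ?thesis
    by (rule measurable_bounded_by_integrable_imp_absolutely_integrable[OF _ _ hi bd])
      (auto intro!: measurable_restrict_space1 measurable_completion)
qed

lemma second_diff_integrable:
  assumes "0 < \<beta>" "\<beta> < 2 * s" "s < 1"
  shows "(\<lambda>t. second_diff \<beta> t * t powr (-1-2 * s)) absolutely_integrable_on {0..}"
proof -
  have "{0..1} \<union> {1..} = {0::real..}" by auto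
  moreover have "(\<lambda>t. second_diff \<beta> t * t powr (-1-2 * s)) absolutely_integrable_on {0..1} \<union> {1..}"
    by (intro absolutely_integrable_Un second_diff_integrable_inside(1)
        second_diff_integrable_outside) (use assms in auto)
  ultimately show ?thesis by simp
qed

section \<open>Sign of the one-dimensional integral\<close>

text \<open>The borderline case \<beta> = s, in which the two exponents are s and s-1. With r = 1-x
  the bracket factors as (1 - r^s)(r^(s-1) - 1), and the numerator of the antiderivative is the
  square of the first factor.\<close>

lemma compactified_sum_FTC:
  fixes s e :: real
  assumes "0 < s" "s < 1" "0 < e" "e < 1"
  shows "((\<lambda>x. ((1-x) powr s + (1-x) powr (s-1) - 1 - (1-x) powr (2 * s-1)) * x powr (-1-2 * s))
    has_integral (1 - (1 - (1-e) powr s)\<^sup>2 * e powr (-2 * s)) / (2 * s)) {e..1}"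
proof -
  define F where "F x = (1 - (1-x) powr s)\<^sup>2 * x powr (-2 * s) / (2 * s)" for x
  have "((\<lambda>x. ((1-x) powr s + (1-x) powr (s-1) - 1 - (1-x) powr (2 * s-1)) * x powr (-1-2 * s))
    has_integral F 1 - F e) {e..1}"
  \<comment> \<open>The integrand is unbounded at x = 1, where \<open>F\<close> is merely
    continuous, so the derivative is required only in the interior.\<close>
  proof (rule fundamental_theorem_of_calculus_interior)
    show "continuous_on {e..1} F"
      unfolding F_def using assms by (intro continuous_intros continuous_on_powr') auto
    fix x assume x: "x \<in> {e<..<1}"
    then have x0: "0 < x" "0 < 1 - x" using assms by auto
    define r where "r = 1 - x"
    have "(F has_real_derivative
        (2 * (1 - r powr s) * (s * r powr (s-1)) * x powr (-2 * s) +
         (1 - r powr s)\<^sup>2 * (-2 * s * x powr (-2 * s - 1))) / (2 * s)) (at x)"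
      unfolding F_def r_def using x0 assms
      by (auto intro!: derivative_eq_intros simp: field_simps)
    moreover have "(2 * (1 - r powr s) * (s * r powr (s-1)) * x powr (-2 * s) +
         (1 - r powr s)\<^sup>2 * (-2 * s * x powr (-2 * s - 1))) / (2 * s) =
        (r powr s + r powr (s-1) - 1 - r powr (2 * s-1)) * x powr (-1-2 * s)"
    proof -
      have px: "x powr (-2 * s) = x * x powr (-1-2 * s)"
        using x0 powr_add[of x 1 "-1-2 * s"] by simp
      have qx: "x powr (-2 * s - 1) = x powr (-1-2 * s)"
        by (rule arg_cong[of _ _ "\<lambda>a. x powr a"]) simp
      have r0: "0 < r" using x0 by (simp add: r_def)
      have pr: "r powr s = r * r powr (s-1)"
        using r0 powr_add[of r 1 "s-1"] by simp
      have qr: "r powr (2 * s-1) = r * r powr (s-1) * r powr (s-1)"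
        using r0 powr_add[of r s "s-1"] pr by simp
      define a w where "a = r powr (s-1)" and "w = x powr (-1-2 * s)"
      have x: "x = 1 - r" by (simp add: r_def)
      have "(2 * (1 - r * a) * (s * a) * (x * w) + (1 - r * a)\<^sup>2 * (-2 * s * w)) / (2 * s) =
         (1 - r * a) * a * x * w - (1 - r * a)\<^sup>2 * w"
        using assms by (simp add: field_simps)
      also have "\<dots> = (r * a + a - 1 - r * a * a) * w"
        by (simp add: x power2_eq_square algebra_simps)
      finally show ?thesis unfolding px qx qr pr a_def w_def .
    qed
    ultimately show "(F has_vector_derivative
        ((1-x) powr s + (1-x) powr (s-1) - 1 - (1-x) powr (2 * s-1)) * x powr (-1-2 * s)) (at x)"
      by (simp add: has_real_derivative_iff_has_vector_derivative r_def)
  qed (use assms in auto)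
  also have "F 1 - F e = (1 - (1 - (1-e) powr s)\<^sup>2 * e powr (-2 * s)) / (2 * s)"
    by (simp add: F_def diff_divide_distrib)
  finally show ?thesis .
qed

section \<open>Compactification of the cut-off integral\<close>

lemma abs_integrable_Icc_Ici:
  fixes f :: "real \<Rightarrow> real"
  assumes "f absolutely_integrable_on {a..b}" "f absolutely_integrable_on {b..}" "a \<le> b"
  shows "f absolutely_integrable_on {a..}"
    and "integral {a..} f = integral {a..b} f + integral {b..} f"
proof -
  have u: "{a..b} \<union> {b..} = {a..}" using assms(3) by auto
  have i: "{a..b} \<inter> {b..} = {b}" using assms(3) by auto
  show "f absolutely_integrable_on {a..}"
    using absolutely_integrable_Un[OF assms(1,2)] by (simp add: u)
  have "integral ({a..b} \<union> {b..}) f = integral {a..b} f + integral {b..} f"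
    by (rule integral_Un) (use assms in \<open>auto simp: i absolutely_integrable_on_def\<close>)
  then show "integral {a..} f = integral {a..b} f + integral {b..} f" by (simp add: u)
qed

text \<open>With t = x/(1-x) one has 1+t = 1/(1-x) and dt = dx/(1-x)^2. The kernel contributes
  (1-x)^(1+2s) and the Jacobian (1-x)^(-2), whence the exponent 2s-1; the power of 1+t lowers it by
  \<beta>. The right endpoint is left out because it corresponds to t = infinity.\<close>

lemma powr_tail_change_of_variables:
  fixes \<beta> s e :: real
  assumes "0 < e"
    and "(\<lambda>t. ((1+t) powr \<beta> - 1) * t powr (-1-2 * s)) absolutely_integrable_on {e..}"
  shows "(\<lambda>x. ((1-x) powr (2 * s-1-\<beta>) - (1-x) powr (2 * s-1)) * x powr (-1-2 * s))
      absolutely_integrable_on {e/(1+e)..<1}" (is "?q absolutely_integrable_on ?S")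
    and "integral {e/(1+e)..<1}
      (\<lambda>x. ((1-x) powr (2 * s-1-\<beta>) - (1-x) powr (2 * s-1)) * x powr (-1-2 * s)) =
      integral {e..} (\<lambda>t. ((1+t) powr \<beta> - 1) * t powr (-1-2 * s))"
proof -
  define g where "g x = x / (1 - x)" for x :: real
  let ?p = "\<lambda>t. ((1+t) powr \<beta> - 1) * t powr (-1-2 * s)"
  have img: "g ` ?S = {e..}"
  proof (rule set_eqI)
    fix t
    show "t \<in> g ` ?S \<longleftrightarrow> t \<in> {e..}"
    proof
      assume "t \<in> g ` ?S"
      then obtain x where "e/(1+e) \<le> x" "x < 1" "t = g x" by auto
      moreover from this have "e * (1 - x) \<le> x"
        using assms(1) by (simp add: pos_divide_le_eq algebra_simps)
      ultimately show "t \<in> {e..}" by (simp add: g_def pos_le_divide_eq)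
    next
      assume "t \<in> {e..}"
      then have t: "e \<le> t" by simp
      have "t / (1+t) \<in> ?S" using t assms(1) by (auto simp: field_simps)
      moreover have "t = g (t / (1+t))" using t assms(1) by (auto simp: g_def field_simps)
      ultimately show "t \<in> g ` ?S" by blast
    qed
  qed
  have der: "(g has_real_derivative 1 / (1-x)\<^sup>2) (at x within ?S)" if "x \<in> ?S" for x
    unfolding g_def using that
    by (auto intro!: derivative_eq_intros simp: power2_eq_square field_simps)
  have inj: "inj_on g ?S"
    by (rule inj_onI) (auto simp: g_def field_simps)
  have "\<bar>1 / (1-x)\<^sup>2\<bar> * ?p (g x) = ?q x" if "x \<in> ?S" for x
  proof -
    have "0 < e / (1+e)" using assms(1) by simp
    with that have x: "0 < x" "0 < 1 - x" by auto
    have 1: "1 + g x = (1-x) powr (-1)" using x by (simp add: g_def powr_minus_divide field_simps)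
    have 2: "g x = x * (1-x) powr (-1)" using x by (simp add: g_def powr_minus_divide)
    have 3: "(1 + g x) powr \<beta> = (1-x) powr (-\<beta>)" unfolding 1 powr_powr by simp
    have 4: "g x powr (-1-2 * s) = x powr (-1-2 * s) * (1-x) powr (1+2 * s)"
    proof -
      define y where "y = (1-x) powr (-1)"
      have "(x * y) powr (-1-2 * s) = x powr (-1-2 * s) * y powr (-1-2 * s)"
        by (rule powr_mult)
      moreover have "y powr (-1-2 * s) = (1-x) powr (1+2 * s)"
        unfolding y_def powr_powr by (rule arg_cong[of _ _ "\<lambda>a. (1-x) powr a"]) simp
      ultimately show ?thesis unfolding 2 y_def by (simp only:)
    qed
    have 5: "\<bar>1 / (1-x)\<^sup>2\<bar> = (1-x) powr (-2)"
      using x by (simp add: powr_minus_divide powr_numeral)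
    have 6: "(1-x) powr (-2) * (1-x) powr (1+2 * s) = (1-x) powr (2 * s-1)"
      by (simp flip: powr_add)
    have 7: "(1-x) powr (2 * s-1) * (1-x) powr (-\<beta>) = (1-x) powr (2 * s-1-\<beta>)"
      by (simp flip: powr_add)
    have "\<bar>1 / (1-x)\<^sup>2\<bar> * ?p (g x) =
        ((1-x) powr (-2) * (1-x) powr (1+2 * s)) * ((1-x) powr (-\<beta>) - 1) * x powr (-1-2 * s)"
      unfolding 3 4 5 by simp
    also have "\<dots> = ?q x"
      unfolding 6 by (simp add: right_diff_distrib 7)
    finally show ?thesis .
  qed
  note eq = this
  have "(\<lambda>x. \<bar>1 / (1-x)\<^sup>2\<bar> * ?p (g x)) absolutely_integrable_on ?S \<and>
      integral ?S (\<lambda>x. \<bar>1 / (1-x)\<^sup>2\<bar> * ?p (g x)) = integral {e..} ?p"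
    using has_absolute_integral_change_of_variables_1'[OF _ der inj, of ?p "integral {e..} ?p"] assms(2)
    by (simp add: img)
  moreover have "(\<lambda>x. \<bar>1 / (1-x)\<^sup>2\<bar> * ?p (g x)) absolutely_integrable_on ?S \<longleftrightarrow>
      ?q absolutely_integrable_on ?S"
    by (rule set_integrable_cong[OF refl refl eq])
  moreover have "integral ?S (\<lambda>x. \<bar>1 / (1-x)\<^sup>2\<bar> * ?p (g x)) = integral ?S ?q"
    by (rule Henstock_Kurzweil_Integration.integral_cong[OF eq])
  ultimately show "?q absolutely_integrable_on ?S" "integral ?S ?q = integral {e..} ?p"
    by simp_all
qed

lemma has_integral_Ico_iff:
  fixes f :: "real \<Rightarrow> real"
  shows "(f has_integral I) {a..<b} \<longleftrightarrow> (f has_integral I) {a..b}"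
  by (rule has_integral_spike_set_eq) (rule negligible_subset[of "{b}"]; auto)+

text \<open>The substitution \<open>t = x/(1-x)\<close> in the part with \<open>1+t\<close> brings both parts to the unit
  interval. For \<open>\<beta> = s\<close> the sum of the two integrands has an elementary antiderivative.\<close>

lemma second_diff_tail:
  fixes \<beta> s e :: real
  assumes "0 < \<beta>" "\<beta> < 2 * s" "0 < s" "s < 1" "0 < e" "e < 1"
  shows "(\<lambda>x. ((1-x) powr (2 * s-1-\<beta>) - (1-x) powr (2 * s-1)) * x powr (-1-2 * s))
      absolutely_integrable_on {e/(1+e)..<1}"
    and "2 * integral {e..} (\<lambda>t. second_diff \<beta> t * t powr (-1-2 * s)) =
      integral {e/(1+e)..<1}
        (\<lambda>x. ((1-x) powr (2 * s-1-\<beta>) - (1-x) powr (2 * s-1)) * x powr (-1-2 * s))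
      + integral {e..1} (\<lambda>x. ((1-x) powr \<beta> - 1) * x powr (-1-2 * s)) - 1 / (2 * s)"
proof -
  let ?w = "\<lambda>t::real. t powr (-1-2 * s)"
  let ?p = "\<lambda>t. ((1+t) powr \<beta> - 1) * ?w t"
  let ?r = "\<lambda>t. ((1-t) powr \<beta> - 1) * ?w t"
  let ?d = "\<lambda>t. second_diff \<beta> t * ?w t"
  \<comment> \<open>For t >= 1 the part with 1 - t is truncated to the constant -1, and its integral
    is the term -1/(2s).\<close>
  have w: "(?w has_integral 1 / (2 * s)) {1..}"
    using has_integral_powr_to_inf[of "-1-2 * s" 1] assms by simp
  have wa: "?w absolutely_integrable_on {1..}"
    by (rule nonnegative_absolutely_integrable_1) (use w in auto)
  have da: "?d absolutely_integrable_on {1..}"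
    by (rule second_diff_integrable_outside) (use assms in auto)
  have pd: "?p t = 2 * ?d t + ?w t" if "t \<in> {1..}" for t
    using that by (simp add: second_diff_outside algebra_simps)
  have "(\<lambda>t. 2 * ?d t + ?w t) absolutely_integrable_on {1..}"
    by (rule set_integral_add(1)[OF _ wa], rule set_integrable_mult_right, rule da)
  moreover have "?p absolutely_integrable_on {1..} \<longleftrightarrow>
      (\<lambda>t. 2 * ?d t + ?w t) absolutely_integrable_on {1..}"
    by (rule set_integrable_cong[OF refl refl pd])
  ultimately have p1: "?p absolutely_integrable_on {1..}" by simp
  have "integral {1..} ?p = integral {1..} (\<lambda>t. 2 * ?d t + ?w t)"
    by (rule Henstock_Kurzweil_Integration.integral_cong[OF pd])
  also have "\<dots> = 2 * integral {1..} ?d + 1 / (2 * s)"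
    using w da by (subst Henstock_Kurzweil_Integration.integral_add)
      (auto simp: absolutely_integrable_on_def integral_unique)
  finally have ip1: "integral {1..} ?p = 2 * integral {1..} ?d + 1 / (2 * s)" .
  have p0: "?p absolutely_integrable_on {e..1}"
    by (rule absolutely_integrable_continuous_real)
      (use assms in \<open>auto intro!: continuous_intros\<close>)
  have r0: "?r absolutely_integrable_on {e..1}"
    by (rule absolutely_integrable_continuous_real)
      (use assms in \<open>auto intro!: continuous_intros continuous_on_powr'\<close>)
  have d0: "?d absolutely_integrable_on {e..1}"
    by (rule absolutely_integrable_on_subinterval[OF second_diff_integrable_inside(1)[of \<beta> s 1]])
      (use assms in auto)
  have dpr: "2 * ?d t = ?p t + ?r t" if "t \<in> {e..1}" for t
    using that assms by (simp add: second_diff_inside algebra_simps)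
  have "2 * integral {e..1} ?d = integral {e..1} (\<lambda>t. 2 * ?d t)" by simp
  also have "\<dots> = integral {e..1} (\<lambda>t. ?p t + ?r t)"
    by (rule Henstock_Kurzweil_Integration.integral_cong[OF dpr])
  also have "\<dots> = integral {e..1} ?p + integral {e..1} ?r"
    by (rule Henstock_Kurzweil_Integration.integral_add)
      (use p0 r0 in \<open>auto simp: absolutely_integrable_on_def\<close>)
  finally have id0: "2 * integral {e..1} ?d = integral {e..1} ?p + integral {e..1} ?r" .
  have e1: "e \<le> 1" using assms by simp
  note P = abs_integrable_Icc_Ici[OF p0 p1 e1]
  note D = abs_integrable_Icc_Ici[OF d0 da e1]
  note Q = powr_tail_change_of_variables[OF assms(5) P(1)]
  show "(\<lambda>x. ((1-x) powr (2 * s-1-\<beta>) - (1-x) powr (2 * s-1)) * x powr (-1-2 * s))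
      absolutely_integrable_on {e/(1+e)..<1}" by (rule Q(1))
  show "2 * integral {e..} (\<lambda>t. second_diff \<beta> t * t powr (-1-2 * s)) =
      integral {e/(1+e)..<1}
        (\<lambda>x. ((1-x) powr (2 * s-1-\<beta>) - (1-x) powr (2 * s-1)) * x powr (-1-2 * s))
      + integral {e..1} (\<lambda>x. ((1-x) powr \<beta> - 1) * x powr (-1-2 * s)) - 1 / (2 * s)"
    unfolding Q(2) P(2) D(2) distrib_left id0 ip1 by simp
qed

text \<open>With u = r^(\<beta>-s) and v = r^(2s-1-\<beta>), the difference of the two sums is v
  (1-u) (1-ru). Since ru = r^(1+\<beta>-s) <= 1, the sign is that of 1-u, which depends only on the
  order of \<beta> and s.\<close>

lemma powr_sum_compare:
  fixes r s \<beta> :: real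
  assumes "0 < r" "r \<le> 1" "0 < \<beta>" "0 < s" "s < 1"
  shows "s \<le> \<beta> \<Longrightarrow> r powr s + r powr (s-1) \<le> r powr \<beta> + r powr (2 * s-1-\<beta>)"
    and "\<beta> \<le> s \<Longrightarrow> r powr \<beta> + r powr (2 * s-1-\<beta>) \<le> r powr s + r powr (s-1)"
proof -
  define u where "u = r powr (\<beta>-s)"
  define v where "v = r powr (2 * s-1-\<beta>)"
  have u: "0 < u" and v: "0 < v" using assms by (simp_all add: u_def v_def)
  have 1: "r powr (s-1) = u * v" by (simp add: u_def v_def flip: powr_add)
  have 2: "r powr s = r * u * v"
    using assms powr_add[of r 1 "s-1"] 1 by simp
  have 3: "r powr \<beta> = r * u * v * u"
    using powr_add[of r s "\<beta>-s"] 2 by (simp add: u_def)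
  have eq: "r powr \<beta> + v - (r powr s + r powr (s-1)) = v * ((1 - u) * (1 - r * u))"
    unfolding 1 2 3 by (simp add: algebra_simps)
  have ru: "r * u = r powr (1 + \<beta> - s)"
    using assms powr_add[of r 1 "\<beta>-s"] by (simp add: u_def algebra_simps)
  have ru1: "r * u \<le> 1" unfolding ru using assms by (intro powr_le1) auto
  show "r powr s + r powr (s-1) \<le> r powr \<beta> + r powr (2 * s-1-\<beta>)" if "s \<le> \<beta>"
  proof -
    have "u \<le> 1" unfolding u_def using assms that by (intro powr_le1) auto
    then have "0 \<le> v * ((1 - u) * (1 - r * u))" using ru1 v by simp
    then show ?thesis using eq unfolding v_def by linarith
  qed
  show "r powr \<beta> + r powr (2 * s-1-\<beta>) \<le> r powr s + r powr (s-1)" if "\<beta> \<le> s"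
  proof -
    have "r powr 0 \<le> u" unfolding u_def using assms that by (intro powr_mono') auto
    then have "1 \<le> u" using assms by simp
    then have "v * ((1 - u) * (1 - r * u)) \<le> 0"
      using ru1 v by (intro mult_nonneg_nonpos mult_nonpos_nonneg) auto
    then show ?thesis using eq unfolding v_def by linarith
  qed
qed

text \<open>Splitting off the gap between the two cut-offs leaves both integrands on the same
  interval, where they can be added and compared pointwise with the case \<beta> = s.\<close>

lemma second_diff_tail_split:
  fixes \<beta> s e :: real
  assumes "0 < \<beta>" "\<beta> < 2 * s" "0 < s" "s < 1" "0 < e" "e < 1"
  obtains H where
    "((\<lambda>x. ((1-x) powr \<beta> + (1-x) powr (2 * s-1-\<beta>) - 1 - (1-x) powr (2 * s-1)) *
      x powr (-1-2 * s)) has_integral H) {e..1}"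
    and "(\<lambda>x. ((1-x) powr (2 * s-1-\<beta>) - (1-x) powr (2 * s-1)) * x powr (-1-2 * s))
      integrable_on {e/(1+e)..e}"
    and "2 * integral {e..} (\<lambda>t. second_diff \<beta> t * t powr (-1-2 * s)) =
      integral {e/(1+e)..e}
        (\<lambda>x. ((1-x) powr (2 * s-1-\<beta>) - (1-x) powr (2 * s-1)) * x powr (-1-2 * s))
      + H - 1 / (2 * s)"
proof -
  let ?w = "\<lambda>t::real. t powr (-1-2 * s)"
  let ?q = "\<lambda>x. ((1-x) powr (2 * s-1-\<beta>) - (1-x) powr (2 * s-1)) * ?w x"
  let ?r = "\<lambda>t. ((1-t) powr \<beta> - 1) * ?w t"
  let ?e = "e / (1+e)"
  note T = second_diff_tail[OF assms]
  have e': "0 < ?e" "?e \<le> e" using assms by (auto simp: field_simps)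
  have un: "{?e..e} \<union> {e..<1} = {?e..<1}" using e' assms by auto
  have int: "{?e..e} \<inter> {e..<1} = {e}" using e' assms by auto
  have q1: "?q integrable_on {?e..e}"
    by (rule set_lebesgue_integral_eq_integral(1), rule set_integrable_subset[OF T(1)])
      (use assms in auto)
  have q2: "?q integrable_on {e..<1}"
    by (rule set_lebesgue_integral_eq_integral(1), rule set_integrable_subset[OF T(1)])
      (use e' in auto)
  have sp: "integral {?e..<1} ?q = integral {?e..e} ?q + integral {e..<1} ?q"
    using integral_Un[OF q1 q2] by (simp add: un int)
  have q3: "(?q has_integral integral {e..<1} ?q) {e..1}"
    using q2 has_integral_Ico_iff by (simp add: has_integral_integral)
  have r: "(?r has_integral integral {e..1} ?r) {e..1}"
    by (rule integrable_integral, rule integrable_continuous_real)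
      (use assms in \<open>auto intro!: continuous_intros continuous_on_powr'\<close>)
  have "((\<lambda>x. ?q x + ?r x) has_integral (integral {e..<1} ?q + integral {e..1} ?r)) {e..1}"
    by (rule has_integral_add[OF q3 r])
  then have H: "((\<lambda>x. ((1-x) powr \<beta> + (1-x) powr (2 * s-1-\<beta>) - 1 - (1-x) powr (2 * s-1)) *
      ?w x) has_integral (integral {e..<1} ?q + integral {e..1} ?r)) {e..1}"
    by (simp add: algebra_simps)
  show thesis
    by (rule that[OF H q1]) (use T(2) sp in simp)
qed

text \<open>Between the cut-offs x is comparable to e. The factor 64 is 2 * 8 * 4, from r^(2s-1) <=
  2, r^(-\<beta>) - 1 <= 8x and x^(-2s) <= 4 e^(-2s), where r = 1-x lies in [1/2, 1].\<close>

lemma powr_tail_error_bound: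
  fixes \<beta> s e x :: real
  assumes "0 < \<beta>" "\<beta> < 2" "0 < s" "s < 1" "0 < e" "e \<le> 1/2" "x \<in> {e/(1+e)..e}"
  shows "0 \<le> ((1-x) powr (2 * s-1-\<beta>) - (1-x) powr (2 * s-1)) * x powr (-1-2 * s)"
    and "((1-x) powr (2 * s-1-\<beta>) - (1-x) powr (2 * s-1)) * x powr (-1-2 * s) \<le>
      64 * e powr (-2 * s)"
proof -
  have "e/2 \<le> e / (1+e)" using assms by (intro divide_left_mono) auto
  also have "\<dots> \<le> x" using assms(7) by simp
  finally have x: "e/2 \<le> x" .
  then have x: "e/2 \<le> x" "0 < x" "x \<le> 1/2" using assms(5-7) by (simp_all only: atLeastAtMost_iff) linarith+
  define r where "r = 1 - x"
  have r: "1/2 \<le> r" "r \<le> 1" using x by (auto simp: r_def)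
  have "r powr (2 * s-1) \<le> r powr (2 * s-1-\<beta>)"
    using r assms by (intro powr_mono') auto
  then show "0 \<le> ((1-x) powr (2 * s-1-\<beta>) - (1-x) powr (2 * s-1)) * x powr (-1-2 * s)"
    by (simp add: r_def)
  have a: "r powr (-\<beta>) \<le> r powr (-2)"
    using r assms by (intro powr_mono') auto
  also have "\<dots> \<le> 1 + 8 * x"
  proof -
    have "1 \<le> (1 + 8 * x) * (1 - x)\<^sup>2"
    proof -
      have "(1 + 8 * x) * (1 - x)\<^sup>2 - 1 = x * (6 - 15 * x + 8 * x\<^sup>2)"
        by (simp add: power2_eq_square algebra_simps)
      moreover have "0 \<le> 6 - 15 * x + 8 * x\<^sup>2"
      proof -
        have "6 - 15 * x + 8 * x\<^sup>2 = (1/2 - x) * (11 - 8 * x) + 1/2"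
          by (simp add: power2_eq_square algebra_simps)
        then show ?thesis using x by simp
      qed
      ultimately show ?thesis using x by (smt (verit) mult_nonneg_nonneg)
    qed
    then show ?thesis
      using r by (simp add: powr_minus_divide powr_numeral pos_divide_le_eq r_def)
  qed
  finally have A: "r powr (-\<beta>) - 1 \<le> 8 * x" by simp
  have "r powr (2 * s-1) \<le> r powr (-1)" using r assms by (intro powr_mono') auto
  also have "\<dots> \<le> 2" using r by (simp add: powr_minus_divide field_simps)
  finally have B: "r powr (2 * s-1) \<le> 2" .
  have "x powr (-2 * s) \<le> (e/2) powr (-2 * s)"
    using x assms by (intro powr_mono2') auto
  also have "\<dots> = e powr (-2 * s) * 2 powr (2 * s)"
    using assms by (simp add: powr_divide powr_minus_divide)
  also have "\<dots> \<le> e powr (-2 * s) * 2 powr 2"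
    using assms by (intro mult_left_mono powr_mono) auto
  finally have C: "x powr (-2 * s) \<le> 4 * e powr (-2 * s)" by simp
  have "r powr (2 * s-1-\<beta>) - r powr (2 * s-1) = r powr (2 * s-1) * (r powr (-\<beta>) - 1)"
    by (simp add: right_diff_distrib flip: powr_add)
  also have "\<dots> \<le> r powr (2 * s-1) * (8 * x)" by (rule mult_left_mono[OF A]) simp
  also have "\<dots> \<le> 2 * (8 * x)" by (rule mult_right_mono[OF B]) (use x in simp)
  finally have "(r powr (2 * s-1-\<beta>) - r powr (2 * s-1)) * x powr (-1-2 * s) \<le>
      2 * (8 * x) * x powr (-1-2 * s)" by (rule mult_right_mono) simp
  also have "\<dots> = 16 * x powr (-2 * s)"
    using x powr_add[of x 1 "-1-2 * s"] by simp
  also have "\<dots> \<le> 64 * e powr (-2 * s)" using C by simp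
  finally show "((1-x) powr (2 * s-1-\<beta>) - (1-x) powr (2 * s-1)) * x powr (-1-2 * s) \<le>
      64 * e powr (-2 * s)" by (simp add: r_def)
qed

text \<open>The value 1/(2s) of the antiderivative at x = 1 cancels the term -1/(2s). What remains
  is the value \<open>R / (2 * s)\<close> at the cut-off and the gap integral. Both are nonnegative
  and enter with opposite signs, so each direction discards one and estimates the other.\<close>

lemma second_diff_tail_bounds:
  fixes \<beta> s e :: real
  assumes "0 < \<beta>" "\<beta> < 2 * s" "0 < s" "s < 1" "0 < e" "e \<le> 1/2"
  shows "s \<le> \<beta> \<Longrightarrow>
      - (1 / (2 * s)) * e powr (2-2 * s) \<le> 2 * integral {e..} (\<lambda>t. second_diff \<beta> t * t powr (-1-2 * s))"
    and "\<beta> \<le> s \<Longrightarrow>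
      2 * integral {e..} (\<lambda>t. second_diff \<beta> t * t powr (-1-2 * s)) \<le> 64 * e powr (2-2 * s)"
proof -
  let ?w = "\<lambda>t::real. t powr (-1-2 * s)"
  let ?q = "\<lambda>x. ((1-x) powr (2 * s-1-\<beta>) - (1-x) powr (2 * s-1)) * ?w x"
  let ?e = "e / (1+e)"
  have lt: "e < 1" and b2: "\<beta> < 2" using assms by auto
  obtain H where H: "((\<lambda>x. ((1-x) powr \<beta> + (1-x) powr (2 * s-1-\<beta>) - 1 - (1-x) powr (2 * s-1)) *
      ?w x) has_integral H) {e..1}"
    and qi: "?q integrable_on {?e..e}"
    and eq: "2 * integral {e..} (\<lambda>t. second_diff \<beta> t * ?w t) =
      integral {?e..e} ?q + H - 1 / (2 * s)"
    by (rule second_diff_tail_split[OF assms(1-5) lt])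
  define R where "R = (1 - (1-e) powr s)\<^sup>2 * e powr (-2 * s)"
  have K: "((\<lambda>x. ((1-x) powr s + (1-x) powr (s-1) - 1 - (1-x) powr (2 * s-1)) * ?w x)
      has_integral (1 - R) / (2 * s)) {e..1}"
    unfolding R_def by (rule compactified_sum_FTC) (use assms in auto)
  \<comment> \<open>The endpoint x = 1 is treated apart: there every power is
    \<open>0 powr a\<close>, which is 0.\<close>
  have cmp: "((1-x) powr s + (1-x) powr (s-1) \<le> (1-x) powr \<beta> + (1-x) powr (2 * s-1-\<beta>))"
    if "s \<le> \<beta>" "x \<in> {e..1}" for x
    using powr_sum_compare(1)[of "1-x" \<beta> s] that assms by (cases "x = 1") auto
  have cmp': "(1-x) powr \<beta> + (1-x) powr (2 * s-1-\<beta>) \<le> (1-x) powr s + (1-x) powr (s-1)"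
    if "\<beta> \<le> s" "x \<in> {e..1}" for x
    using powr_sum_compare(2)[of "1-x" \<beta> s] that assms by (cases "x = 1") auto
  have "(1-e) powr 1 \<le> (1-e) powr s" using assms by (intro powr_mono') auto
  then have "1 - (1-e) powr s \<le> e" using assms by simp
  moreover have "(1-e) powr s \<le> 1" using assms by (intro powr_le1) auto
  ultimately have "(1 - (1-e) powr s)\<^sup>2 \<le> e\<^sup>2" by (intro power_mono) auto
  then have "R \<le> e\<^sup>2 * e powr (-2 * s)" unfolding R_def by (rule mult_right_mono) simp
  also have e2: "e\<^sup>2 * e powr (-2 * s) = e powr (2-2 * s)"
    using assms powr_add[of e 2 "-2 * s"] by (simp add: powr_numeral)
  finally have R: "R \<le> e powr (2-2 * s)" .
  have R0: "0 \<le> R" by (simp add: R_def)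
  show "- (1 / (2 * s)) * e powr (2-2 * s) \<le> 2 * integral {e..} (\<lambda>t. second_diff \<beta> t * ?w t)"
    if "s \<le> \<beta>"
  proof -
    have "(1 - R) / (2 * s) \<le> H"
      by (rule has_integral_le[OF K H]) (intro mult_right_mono, use cmp[OF that] in auto)
    moreover have "0 \<le> integral {?e..e} ?q"
      by (rule integral_nonneg[OF qi])
        (rule powr_tail_error_bound(1)[OF assms(1) b2 assms(3-6)])
    moreover have "R / (2 * s) \<le> e powr (2-2 * s) / (2 * s)"
      using R assms by (intro divide_right_mono) auto
    ultimately show ?thesis unfolding eq by (simp add: diff_divide_distrib)
  qed
  show "2 * integral {e..} (\<lambda>t. second_diff \<beta> t * ?w t) \<le> 64 * e powr (2-2 * s)" if "\<beta> \<le> s"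
  proof -
    have "H \<le> (1 - R) / (2 * s)"
      by (rule has_integral_le[OF H K]) (intro mult_right_mono, use cmp'[OF that] in auto)
    moreover have "0 \<le> R / (2 * s)" using R0 assms by simp
    moreover have "integral {?e..e} ?q \<le> 64 * e powr (2-2 * s)"
    proof -
      have le: "?e \<le> e" using assms by (simp add: field_simps)
      have "integral {?e..e} ?q \<le> integral {?e..e} (\<lambda>x. 64 * e powr (-2 * s))"
        by (rule integral_le[OF qi integrable_const_ivl])
          (rule powr_tail_error_bound(2)[OF assms(1) b2 assms(3-6)])
      also have "\<dots> = (e - ?e) * (64 * e powr (-2 * s))" using le by simp
      also have "\<dots> \<le> e\<^sup>2 * (64 * e powr (-2 * s))"
        using assms by (intro mult_right_mono) (auto simp: field_simps power2_eq_square)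
      finally show ?thesis using e2 by simp
    qed
    ultimately show ?thesis unfolding eq by (simp add: diff_divide_distrib)
  qed
qed

section \<open>Removal of the cut-off\<close>

lemma le_0_if_le_powr:
  fixes X C a :: real
  assumes "0 < a" and "\<And>e. 0 < e \<Longrightarrow> e \<le> 1/2 \<Longrightarrow> X \<le> C * e powr a"
  shows "X \<le> 0"
proof (rule tendsto_lowerbound)
  have "((\<lambda>e. e powr a) \<longlongrightarrow> 0) (at_right 0)"
    using assms(1) by (intro tendsto_zero_powrI[of _ _ _ a])
      (auto intro: tendsto_ident_at simp: eventually_at_filter)
  then show "((\<lambda>e. C * e powr a) \<longlongrightarrow> 0) (at_right 0)" by (rule tendsto_mult_right_zero)
  show "\<forall>\<^sub>F e in at_right 0. X \<le> C * e powr a"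
    unfolding eventually_at_right_field using assms(2) by (intro exI[of _ "1/2"]) auto
qed simp

lemma second_diff_integral_sign:
  fixes \<beta> s :: real
  assumes "0 < \<beta>" "\<beta> < 2 * s" "0 < s" "s < 1"
  shows "s \<le> \<beta> \<Longrightarrow> 0 \<le> integral {0..} (\<lambda>t. second_diff \<beta> t * t powr (-1-2 * s))"
    and "\<beta> \<le> s \<Longrightarrow> integral {0..} (\<lambda>t. second_diff \<beta> t * t powr (-1-2 * s)) \<le> 0"
proof -
  let ?d = "\<lambda>t. second_diff \<beta> t * t powr (-1-2 * s)"
  have sp: "\<bar>integral {0..} ?d - integral {e..} ?d\<bar> \<le> e powr (2-2 * s) / (2-2 * s)"
    if "0 < e" "e \<le> 1/2" for e
  proof -
    have i: "?d absolutely_integrable_on {0..e}"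
      by (rule second_diff_integrable_inside(1)) (use assms that in auto)
    have j: "?d absolutely_integrable_on {e..}"
      by (rule set_integrable_subset[OF second_diff_integrable[OF assms(1,2,4)]])
        (use that in auto)
    have "integral {0..} ?d = integral {0..e} ?d + integral {e..} ?d"
      by (rule abs_integrable_Icc_Ici(2)[OF i j]) (use that in auto)
    moreover have "\<bar>integral {0..e} ?d\<bar> \<le> e powr (2-2 * s) / (2-2 * s)"
      by (rule second_diff_integrable_inside(2)) (use assms that in auto)
    ultimately show ?thesis by simp
  qed
  have a: "0 < 2 - 2 * s" using assms by simp
  show "0 \<le> integral {0..} ?d" if "s \<le> \<beta>"
  proof -
    have "- (2 * integral {0..} ?d) \<le> (1 / (2 * s) + 2 / (2-2 * s)) * e powr (2-2 * s)"
      if e: "0 < e" "e \<le> 1/2" for e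
    proof -
      have "- (2 * integral {e..} ?d) \<le> 1 / (2 * s) * e powr (2-2 * s)"
        using second_diff_tail_bounds(1)[OF assms e \<open>s \<le> \<beta>\<close>] by simp
      then show ?thesis using sp[OF e] unfolding distrib_right by (simp add: abs_le_iff)
    qed
    from le_0_if_le_powr[OF a this] show ?thesis by simp
  qed
  show "integral {0..} ?d \<le> 0" if "\<beta> \<le> s"
  proof -
    have "2 * integral {0..} ?d \<le> (64 + 2 / (2-2 * s)) * e powr (2-2 * s)"
      if e: "0 < e" "e \<le> 1/2" for e
    proof -
      have "2 * integral {e..} ?d \<le> 64 * e powr (2-2 * s)"
        using second_diff_tail_bounds(2)[OF assms e \<open>\<beta> \<le> s\<close>] by simp
      then show ?thesis using sp[OF e] unfolding distrib_right by (simp add: abs_le_iff)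
    qed
    from le_0_if_le_powr[OF a this] show ?thesis by simp
  qed
qed

section \<open>Strict inequality for monotone weights\<close>

lemma integral_pos_if_cont_pos:
  fixes f :: "real \<Rightarrow> real"
  assumes "f integrable_on {c..}" and "\<And>t. c \<le> t \<Longrightarrow> 0 \<le> f t"
    and "c \<le> a" "a < b" "continuous_on {a..b} f" "\<And>t. t \<in> {a..b} \<Longrightarrow> 0 < f t"
  shows "0 < integral {c..} f"
proof -
  obtain m where m: "m \<in> {a..b}" "\<And>t. t \<in> {a..b} \<Longrightarrow> f m \<le> f t"
    using continuous_attains_inf[OF _ _ assms(5)] assms(4) by (auto simp: compact_Icc)
  have "0 < (b - a) * f m" using assms(4) assms(6)[OF m(1)] by simp
  also have "\<dots> = integral {a..b} (\<lambda>t. f m)" using assms(4) by simp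
  also have "\<dots> \<le> integral {a..b} f"
    by (rule integral_le[OF integrable_const_ivl integrable_continuous_real[OF assms(5)] m(2)])
  also have "\<dots> \<le> integral {c..} f"
    by (rule integral_subset_le[OF _ integrable_continuous_real[OF assms(5)] assms(1)])
      (use assms(2,3) in auto)
  finally show ?thesis .
qed

text \<open>Joins the gauge integrals over the closed half-line, where signs are computed, to the
  Lebesgue integral over the open one produced by the reduction in one direction;
  \<open>f 0 = 0\<close> reconciles the endpoints.\<close>

lemma lborel_integral_Ioi:
  fixes f :: "real \<Rightarrow> real"
  assumes [measurable]: "f \<in> borel_measurable borel" and "f absolutely_integrable_on {0..}" "f 0 = 0"
  shows "integrable lborel (\<lambda>t. indicator {0<..} t * f t)"
    and "(LINT t|lborel. indicator {0<..} t * f t) = integral {0..} f"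
proof -
  have eq: "(\<lambda>t. indicator {0<..} t * f t) = (\<lambda>t. indicator {0..} t *\<^sub>R f t)"
    using assms(3) by (auto simp: indicator_def fun_eq_iff less_le)
  have m: "(\<lambda>t. indicator {0..} t *\<^sub>R f t) \<in> borel_measurable lborel" by measurable
  show "integrable lborel (\<lambda>t. indicator {0<..} t * f t)"
    unfolding eq using assms(2) integrable_completion[OF m] by (simp add: set_integrable_def)
  show "(LINT t|lborel. indicator {0<..} t * f t) = integral {0..} f"
    unfolding eq using set_lebesgue_integral_eq_integral(2)[OF assms(2)] integral_completion[OF m]
    by (simp add: set_lebesgue_integral_def)
qed

lemma continuous_on_second_diff:
  assumes "0 < \<beta>"
  shows "continuous_on A (second_diff \<beta>)"
  unfolding second_diff_def
  by (intro continuous_on_diff continuous_on_divide continuous_on_add continuous_on_const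
      continuous_on_powr' continuous_on_max continuous_on_id) (use assms in auto)

text \<open>As \<open>second_diff \<beta>\<close> changes sign only once, at \<open>t\<^sub>0\<close>, comparing the decreasing weight
  \<open>1/(1+t\<^sup>2)\<close> with its value at \<open>t\<^sub>0\<close> gives an integrand of one sign.\<close>

lemma second_diff_weighted_less:
  fixes \<beta> s :: real
  assumes "0 < \<beta>" "\<beta> < 2 * s" "s < 1"
  obtains \<theta> where "0 < \<theta>" "\<theta> \<le> 1"
    and "(\<lambda>t. 1 / (1 + t\<^sup>2) * (second_diff \<beta> t * t powr (-1-2 * s))) absolutely_integrable_on {0..}"
    and "integral {0..} (\<lambda>t. 1 / (1 + t\<^sup>2) * (second_diff \<beta> t * t powr (-1-2 * s))) <
      \<theta> * integral {0..} (\<lambda>t. second_diff \<beta> t * t powr (-1-2 * s))"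
proof -
  let ?d = "\<lambda>t. second_diff \<beta> t * t powr (-1-2 * s)"
  define \<psi> where "\<psi> t = 1 / (1 + t\<^sup>2)" for t :: real
  obtain t0 where t0: "0 \<le> t0"
    "\<And>t. 0 \<le> t \<Longrightarrow> t \<le> t0 \<Longrightarrow> second_diff \<beta> t \<le> 0"
    "\<And>t. t0 \<le> t \<Longrightarrow> 0 \<le> second_diff \<beta> t"
    "\<And>t. t0 < t \<Longrightarrow> 1 < t \<Longrightarrow> 0 < second_diff \<beta> t"
    using second_diff_single_crossing[OF assms(1)] by blast
  have pos: "0 < 1 + t\<^sup>2" for t :: real by (simp add: add_pos_nonneg)
  have anti: "\<psi> y \<le> \<psi> x" if "0 \<le> x" "x \<le> y" for x y
    unfolding \<psi>_def using that pos by (intro divide_left_mono) (auto intro: power_mono)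
  have santi: "\<psi> y < \<psi> x" if "0 \<le> x" "x < y" for x y
    unfolding \<psi>_def using that pos by (intro divide_strict_left_mono) (auto intro: power_strict_mono)
  have d: "?d absolutely_integrable_on {0..}" by (rule second_diff_integrable[OF assms])
  have \<psi>01: "0 < \<psi> t" "\<psi> t \<le> 1" for t using pos[of t] by (auto simp: \<psi>_def)
  have "\<psi> \<in> borel_measurable borel" unfolding \<psi>_def by measurable
  then have m: "\<psi> \<in> borel_measurable (lebesgue_on {0..})"
    by (auto intro!: measurable_restrict_space1 measurable_completion)
  have "bounded (\<psi> ` {0..})"
    by (rule boundedI[of _ 1]) (use \<psi>01 in \<open>auto simp: abs_le_iff less_imp_le intro: order_trans[of _ 0]\<close>)
  then have e: "(\<lambda>t. \<psi> t * ?d t) absolutely_integrable_on {0..}"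
    by (intro absolutely_integrable_bounded_measurable_product_real[OF m _ _ d]) auto
  have di: "?d integrable_on {0..}" and ei: "(\<lambda>t. \<psi> t * ?d t) integrable_on {0..}"
    using d e by (auto simp: absolutely_integrable_on_def)
  let ?k = "\<lambda>t. \<psi> t0 * ?d t - \<psi> t * ?d t"
  have k: "?k t = (\<psi> t0 - \<psi> t) * second_diff \<beta> t * t powr (-1-2 * s)" for t
    by (simp add: algebra_simps)
  \<comment> \<open>A point to the right of both 1 and the crossing: from here on the integrand is
    strictly positive, and it is continuous because 0 is avoided.\<close>
  define a where "a = max t0 1 + 1"
  have a: "t0 < a" "1 < a" by (auto simp: a_def)
  have "0 < integral {0..} ?k"
  proof (rule integral_pos_if_cont_pos)
    show "?k integrable_on {0..}"
      by (intro integrable_diff integrable_on_mult_right di ei)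
    show "0 \<le> ?k t" if "0 \<le> t" for t
      unfolding k
    proof (cases "t \<le> t0")
      case True
      then show "0 \<le> (\<psi> t0 - \<psi> t) * second_diff \<beta> t * t powr (-1-2 * s)"
        using that anti[of t t0] t0(2)[of t] by (intro mult_nonneg_nonneg mult_nonpos_nonpos) auto
    next
      case False
      then show "0 \<le> (\<psi> t0 - \<psi> t) * second_diff \<beta> t * t powr (-1-2 * s)"
        using that anti[of t0 t] t0(1,3) by (intro mult_nonneg_nonneg) auto
    qed
    show "0 \<le> a" "a < a + 1" using a by auto
    show "continuous_on {a..a+1} ?k"
    proof -
      have "continuous_on {a..a+1} \<psi>"
        unfolding \<psi>_def
        by (intro continuous_on_divide continuous_on_add continuous_on_const continuous_on_power
            continuous_on_id) (auto simp: add_nonneg_eq_0_iff)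
      moreover have "continuous_on {a..a+1} (\<lambda>t. t powr (-1-2 * s))"
        by (intro continuous_on_powr continuous_on_const continuous_on_id) (use a in auto)
      ultimately show ?thesis
        by (intro continuous_on_diff continuous_on_mult continuous_on_const
            continuous_on_second_diff[OF assms(1)])
    qed
    show "0 < ?k t" if "t \<in> {a..a+1}" for t
      unfolding k using that a t0(4)[of t] santi[of t0 t] t0(1) by (intro mult_pos_pos) auto
  qed
  also have "integral {0..} ?k = \<psi> t0 * integral {0..} ?d - integral {0..} (\<lambda>t. \<psi> t * ?d t)"
    using di ei by (subst Henstock_Kurzweil_Integration.integral_diff)
      (auto intro: integrable_on_mult_right)
  finally have less: "integral {0..} (\<lambda>t. \<psi> t * ?d t) < \<psi> t0 * integral {0..} ?d" by simp
  show thesis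
    by (rule that[OF \<psi>01[of t0, unfolded \<psi>_def] e[unfolded \<psi>_def] less[unfolded \<psi>_def]])
qed

text \<open>Evaluation at the single point \<open>\<nu>\<close>, where the numerator depends on y
  only through \<open>y \<bullet> \<nu>\<close>. The value is linear in \<open>c\<close> and
  \<open>d\<close> with a common positive factor, so its sign is that of a combination of two
  one-dimensional integrals.\<close>

lemma integro_op_pos_power_ridge:
  fixes \<nu> :: "'a::euclidean_space"
  assumes "norm \<nu> = 1" "0 < s" "s < 1"
  obtains C where "0 < C"
    and "\<And>\<beta> c d. 0 < \<beta> \<Longrightarrow> \<beta> < 2 * s \<Longrightarrow>
      integro_op s (\<lambda>y. c + d * (1 / (1 + (y \<bullet> \<nu>)\<^sup>2))) (pos_power \<beta> \<nu>) \<nu> =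
      C * (c * integral {0..} (\<lambda>t. second_diff \<beta> t * t powr (-1-2 * s)) +
        d * integral {0..} (\<lambda>t. 1 / (1 + t\<^sup>2) * (second_diff \<beta> t * t powr (-1-2 * s))))"
proof -
  have "0 < 2 * s" using assms by simp
  then obtain C where C: "0 < C"
    and ker: "\<And>G. G \<in> borel_measurable borel \<Longrightarrow> (\<And>t. G (- t) = G t) \<Longrightarrow> G 0 = (0::real) \<Longrightarrow>
      integrable lborel (\<lambda>t. indicator {0<..} t * (G t * t powr (-1-2 * s))) \<Longrightarrow>
      (LINT y|lborel. G (y \<bullet> \<nu>) * norm y powr (- (real DIM('a) + 2 * s))) =
      C * (LINT t|lborel. indicator {0<..} t * (G t * t powr (-1-2 * s)))"
    using integral_ridge_kernel[OF assms(1)] by blast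
  show thesis
  proof (rule that)
    show "0 < (1 - s) * C" using C assms by simp
    fix \<beta> c d :: real
    assume \<beta>: "0 < \<beta>" "\<beta> < 2 * s"
    define G where "G t = second_diff \<beta> t * (c + d * (1 / (1 + t\<^sup>2)))" for t
    let ?d = "\<lambda>t. second_diff \<beta> t * t powr (-1-2 * s)"
    let ?e = "\<lambda>t. 1 / (1 + t\<^sup>2) * (second_diff \<beta> t * t powr (-1-2 * s))"
    have d: "?d absolutely_integrable_on {0..}"
      by (rule second_diff_integrable[OF \<beta> assms(3)])
    have e: "?e absolutely_integrable_on {0..}"
      using second_diff_weighted_less[OF \<beta> assms(3)] by blast
    have Gw: "G t * t powr (-1-2 * s) = c * ?d t + d * ?e t" for t
      by (simp add: G_def algebra_simps)
    have "(\<lambda>t. c * ?d t + d * ?e t) absolutely_integrable_on {0..}"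
      by (rule set_integral_add(1); rule set_integrable_mult_right, rule d e)
    then have Gi: "(\<lambda>t. G t * t powr (-1-2 * s)) absolutely_integrable_on {0..}"
      by (simp only: Gw)
    have Gm [measurable]: "G \<in> borel_measurable borel" unfolding G_def by measurable
    have "(\<lambda>t. G t * t powr (-1-2 * s)) \<in> borel_measurable borel" by measurable
    moreover have "G 0 * 0 powr (-1-2 * s) = 0" by simp
    ultimately have L: "integrable lborel (\<lambda>t. indicator {0<..} t * (G t * t powr (-1-2 * s)))"
      "(LINT t|lborel. indicator {0<..} t * (G t * t powr (-1-2 * s))) =
        integral {0..} (\<lambda>t. G t * t powr (-1-2 * s))"
      by (rule lborel_integral_Ioi[OF _ Gi])+
    have nn: "\<nu> \<bullet> \<nu> = 1" using assms(1) by (simp add: norm_eq_1)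
    have "integro_op s (\<lambda>y. c + d * (1 / (1 + (y \<bullet> \<nu>)\<^sup>2))) (pos_power \<beta> \<nu>) \<nu> =
        (1 - s) * (LINT y|lborel. G (y \<bullet> \<nu>) * norm y powr (- (real DIM('a) + 2 * s)))"
      unfolding integro_op_def
    proof (rule arg_cong[where f = "\<lambda>q. (1 - s) * q"], rule Bochner_Integration.integral_cong[OF refl])
      fix y :: 'a
      have "(pos_power \<beta> \<nu> (\<nu> + y) + pos_power \<beta> \<nu> (\<nu> - y)) / 2 - pos_power \<beta> \<nu> \<nu> =
          second_diff \<beta> (y \<bullet> \<nu>)"
        by (simp add: pos_power_def second_diff_def inner_add_left inner_diff_left nn)
      then show "((pos_power \<beta> \<nu> (\<nu> + y) + pos_power \<beta> \<nu> (\<nu> - y)) / 2 - pos_power \<beta> \<nu> \<nu>) *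
          ((c + d * (1 / (1 + (y \<bullet> \<nu>)\<^sup>2))) / norm y powr (real DIM('a) + 2 * s)) =
          G (y \<bullet> \<nu>) * norm y powr (- (real DIM('a) + 2 * s))"
        by (simp only: G_def powr_minus divide_inverse mult.assoc)
    qed
    also have "\<dots> = (1 - s) * (C * integral {0..} (\<lambda>t. G t * t powr (-1-2 * s)))"
      unfolding L(2)[symmetric]
      by (subst ker[OF Gm _ _ L(1)]) (simp_all add: G_def second_diff_minus second_diff_0)
    also have "integral {0..} (\<lambda>t. G t * t powr (-1-2 * s)) = c * integral {0..} ?d + d * integral {0..} ?e"
      unfolding Gw
      by (intro integral_unique has_integral_add has_integral_mult_right integrable_integral
          set_lebesgue_integral_eq_integral(1) d e)
    finally show "integro_op s (\<lambda>y. c + d * (1 / (1 + (y \<bullet> \<nu>)\<^sup>2))) (pos_power \<beta> \<nu>) \<nu> =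
        (1 - s) * C * (c * integral {0..} ?d + d * integral {0..} ?e)"
      by simp
  qed
qed

theorem corollary2p8:
  fixes s lam Lam \<beta>\<^sub>1 \<beta>\<^sub>2 :: real
    and \<L> :: "(real ^ 'n) operator set"
    and \<nu> :: "real ^ 'n"
  assumes "0 < s" "s < 1"
    and "0 < lam" "lam < Lam"
    and "\<L> \<in> {class_L0 s lam Lam, class_L1 s lam Lam, class_L2 s lam Lam}"
    and "norm \<nu> = 1"
    and "0 < \<beta>\<^sub>1" "\<beta>\<^sub>1 \<le> \<beta>\<^sub>2" "\<beta>\<^sub>2 < 2 * s"
    and "\<forall>x. x \<bullet> \<nu> > 0 \<longrightarrow> M_plus \<L> (pos_power \<beta>\<^sub>1 \<nu>) x = 0"
    and "\<forall>x. x \<bullet> \<nu> > 0 \<longrightarrow> M_minus \<L> (pos_power \<beta>\<^sub>2 \<nu>) x = 0"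
  shows "\<beta>\<^sub>1 < s \<and> s < \<beta>\<^sub>2"
proof -
  obtain C where C: "0 < C"
    and op: "\<And>\<beta> c d. 0 < \<beta> \<Longrightarrow> \<beta> < 2 * s \<Longrightarrow>
      integro_op s (\<lambda>y. c + d * (1 / (1 + (y \<bullet> \<nu>)\<^sup>2))) (pos_power \<beta> \<nu>) \<nu> =
      C * (c * integral {0..} (\<lambda>t. second_diff \<beta> t * t powr (-1-2 * s)) +
        d * integral {0..} (\<lambda>t. 1 / (1 + t\<^sup>2) * (second_diff \<beta> t * t powr (-1-2 * s))))"
    using integro_op_pos_power_ridge[OF assms(6,1,2)] by blast
  \<comment> \<open>Places \<open>\<nu>\<close> in the half-space, the only point at which the two
    equations are evaluated.\<close>
  have nn: "\<nu> \<bullet> \<nu> > 0" using assms(6) by (simp add: norm_eq_1[THEN iffD1])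
  define D where "D = Lam - lam"
  have D: "0 < D" using assms(4) by (simp add: D_def)
  \<comment> \<open>The two test weights, decreasing and increasing in the distance to the
    hyperplane orthogonal to \<open>\<nu>\<close>, use the full range between the ellipticity
    constants. The bound by \<open>lam\<close> also keeps their values at the crossing
    positive.\<close>
  have range: "lam \<le> lam + D * t \<and> lam + D * t \<le> Lam"
    "lam \<le> Lam + - D * t \<and> Lam + - D * t \<le> Lam" if "0 \<le> t" "t \<le> 1" for t
  proof -
    have "Lam = lam + D" by (simp add: D_def)
    moreover have "D * t \<le> D" "0 \<le> D * t" using that D by (auto simp: mult_left_le)
    ultimately show "lam \<le> lam + D * t \<and> lam + D * t \<le> Lam"
      "lam \<le> Lam + - D * t \<and> Lam + - D * t \<le> Lam" by auto
  qed
  have \<beta>: "0 < \<beta>\<^sub>2" "\<beta>\<^sub>1 < 2 * s" using assms(7-9) by auto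
  have "\<beta>\<^sub>1 < s"
  proof (rule ccontr)
    assume "\<not> \<beta>\<^sub>1 < s"
    then have le: "s \<le> \<beta>\<^sub>1" by simp
    let ?J = "integral {0..} (\<lambda>t. second_diff \<beta>\<^sub>1 t * t powr (-1-2 * s))"
    let ?K = "integral {0..} (\<lambda>t. 1 / (1 + t\<^sup>2) * (second_diff \<beta>\<^sub>1 t * t powr (-1-2 * s)))"
    obtain \<theta> where \<theta>: "0 < \<theta>" "\<theta> \<le> 1" "?K < \<theta> * ?J"
      using second_diff_weighted_less[OF assms(7) \<beta>(2) assms(2)] by blast
    have J: "0 \<le> ?J" by (rule second_diff_integral_sign(1)[OF assms(7) \<beta>(2) assms(1,2) le])
    \<comment> \<open>Here \<open>Lam + - D * \<theta>\<close> is the value of the increasing weight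
      at the sign change, so the term is what freezing the weight there would give; the true value
      is strictly larger.\<close>
    have "0 \<le> (Lam + - D * \<theta>) * ?J"
      using range(2)[of \<theta>] \<theta> J assms(3) by (intro mult_nonneg_nonneg) auto
    also have "\<dots> < Lam * ?J + - D * ?K"
      using mult_strict_left_mono[OF \<theta>(3) D] by (simp add: algebra_simps)
    finally have pos: "0 < integro_op s (\<lambda>y. Lam + - D * (1 / (1 + (y \<bullet> \<nu>)\<^sup>2))) (pos_power \<beta>\<^sub>1 \<nu>) \<nu>"
      unfolding op[OF assms(7) \<beta>(2)] using C by (intro mult_pos_pos)
    have "integro_op s (\<lambda>y. Lam + - D * (1 / (1 + (y \<bullet> \<nu>)\<^sup>2))) \<in> \<L>"
      by (rule integro_op_ridge_mem[OF assms(5) range(2)])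
    then have "ereal (integro_op s (\<lambda>y. Lam + - D * (1 / (1 + (y \<bullet> \<nu>)\<^sup>2))) (pos_power \<beta>\<^sub>1 \<nu>) \<nu>) \<le>
        M_plus \<L> (pos_power \<beta>\<^sub>1 \<nu>) \<nu>"
      unfolding M_plus_def by (rule SUP_upper)
    then show False using pos assms(10) nn by simp
  qed
  moreover have "s < \<beta>\<^sub>2"
  proof (rule ccontr)
    assume "\<not> s < \<beta>\<^sub>2"
    then have le: "\<beta>\<^sub>2 \<le> s" by simp
    let ?J = "integral {0..} (\<lambda>t. second_diff \<beta>\<^sub>2 t * t powr (-1-2 * s))"
    let ?K = "integral {0..} (\<lambda>t. 1 / (1 + t\<^sup>2) * (second_diff \<beta>\<^sub>2 t * t powr (-1-2 * s)))"
    obtain \<theta> where \<theta>: "0 < \<theta>" "\<theta> \<le> 1" "?K < \<theta> * ?J"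
      using second_diff_weighted_less[OF \<beta>(1) assms(9,2)] by blast
    have J: "?J \<le> 0" by (rule second_diff_integral_sign(2)[OF \<beta>(1) assms(9,1,2) le])
    \<comment> \<open>The mirror argument: the decreasing weight puts the value strictly below the
      one frozen at the sign change, which is nonpositive.\<close>
    have "lam * ?J + D * ?K < (lam + D * \<theta>) * ?J"
      using mult_strict_left_mono[OF \<theta>(3) D] by (simp add: algebra_simps)
    also have "\<dots> \<le> 0"
      using range(1)[of \<theta>] \<theta> J assms(3) by (intro mult_nonneg_nonpos) auto
    finally have neg: "integro_op s (\<lambda>y. lam + D * (1 / (1 + (y \<bullet> \<nu>)\<^sup>2))) (pos_power \<beta>\<^sub>2 \<nu>) \<nu> < 0"
      unfolding op[OF \<beta>(1) assms(9)] using C by (intro mult_pos_neg)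
    have "integro_op s (\<lambda>y. lam + D * (1 / (1 + (y \<bullet> \<nu>)\<^sup>2))) \<in> \<L>"
      by (rule integro_op_ridge_mem[OF assms(5) range(1)])
    then have "M_minus \<L> (pos_power \<beta>\<^sub>2 \<nu>) \<nu> \<le>
        ereal (integro_op s (\<lambda>y. lam + D * (1 / (1 + (y \<bullet> \<nu>)\<^sup>2))) (pos_power \<beta>\<^sub>2 \<nu>) \<nu>)"
      unfolding M_minus_def by (rule INF_lower)
    then show False using neg assms(11) nn by simp
  qed
  ultimately show ?thesis by simp
qed

end
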